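(* If there exists an algorithm which, given an instance of \textsc{PVC} on a graph $G=(V,E)$ of treewidth $t$, computes an optimal solution in time $|V|^{o(t)}$, then the Exponential Time Hypothesis (ETH) is false. This holds even if all edge weights are polynomially bounded in $|V|$.
   Context: \textsc{Power Vertex Cover (PVC)}: the input is a finite simple undirected graph $G=(V,E)$ with a positive integer weight $w_e$ on each edge $e\in E$. A feasible solution assigns to each vertex $v\in V$ a value (power) $p_v\ge 0$ such that for every edge $e=(u,v)$ we have $p_u\ge w_e$ or $p_v\ge w_e$. The goal is to minimize $\sum_{v\in V}p_v$. Treewidth is the usual graph parameter defined through tree decompositions. ETH is the standard hypothesis that 3-SAT on $n$ variables cannot be solved in time $2^{o(n)}$. *)

theory Defs
  imports "HOL-Library.Landau_Symbols"
begin

section \<open>Graphs and treewidth\<close>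

definition simple_graph :: "'a set \<Rightarrow> 'a set set \<Rightarrow> bool" where
  "simple_graph V E \<longleftrightarrow> finite V \<and> E \<subseteq> {{u, v} | u v. u \<in> V \<and> v \<in> V \<and> u \<noteq> v}"

text \<open>The subgraph induced by \<open>S\<close> is connected (the empty one included).\<close>

definition connected_in :: "'a set set \<Rightarrow> 'a set \<Rightarrow> bool" where
  "connected_in E S \<longleftrightarrow>
     (\<forall>x\<in>S. \<forall>y\<in>S. (x, y) \<in> {(a, b). a \<in> S \<and> b \<in> S \<and> {a, b} \<in> E}\<^sup>*)"

definition is_cycle :: "'a set set \<Rightarrow> 'a list \<Rightarrow> bool" where
  "is_cycle E vs \<longleftrightarrow> 3 \<le> length vs \<and> distinct vs \<and>
     (\<forall>i < length vs. {vs ! i, vs ! (Suc i mod length vs)} \<in> E)"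

definition is_tree :: "'a set \<Rightarrow> 'a set set \<Rightarrow> bool" where
  "is_tree V E \<longleftrightarrow> simple_graph V E \<and> V \<noteq> {} \<and> connected_in E V \<and> (\<nexists>vs. is_cycle E vs)"

text \<open>The tree has node set \<open>I\<close> and edge set \<open>F\<close>; the bag of node \<open>i\<close> is \<open>B i\<close>.
  Nodes of a finite tree may be taken to be natural numbers.\<close>

definition tree_decomposition ::
  "'a set \<Rightarrow> 'a set set \<Rightarrow> nat set \<Rightarrow> nat set set \<Rightarrow> (nat \<Rightarrow> 'a set) \<Rightarrow> bool" where
  "tree_decomposition V E I F B \<longleftrightarrow> is_tree I F \<and>
     (\<forall>i\<in>I. B i \<subseteq> V) \<and>
     (\<forall>v\<in>V. \<exists>i\<in>I. v \<in> B i) \<and>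
     (\<forall>e\<in>E. \<exists>i\<in>I. e \<subseteq> B i) \<and>
     (\<forall>v\<in>V. connected_in F {i \<in> I. v \<in> B i})"

definition treewidth :: "'a set \<Rightarrow> 'a set set \<Rightarrow> nat" where
  "treewidth V E =
     (LEAST k. \<exists>I F B. tree_decomposition V E I F B \<and> (\<forall>i\<in>I. card (B i) \<le> k + 1))"

section \<open>Power Vertex Cover\<close>

definition pvc_instance :: "'a set \<Rightarrow> 'a set set \<Rightarrow> ('a set \<Rightarrow> nat) \<Rightarrow> bool" where
  "pvc_instance V E w \<longleftrightarrow> simple_graph V E \<and> (\<forall>e\<in>E. w e > 0)"

definition pvc_feasible :: "'a set \<Rightarrow> 'a set set \<Rightarrow> ('a set \<Rightarrow> nat) \<Rightarrow> ('a \<Rightarrow> real) \<Rightarrow> bool" where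
  "pvc_feasible V E w p \<longleftrightarrow> (\<forall>v\<in>V. p v \<ge> 0) \<and>
     (\<forall>u v. {u, v} \<in> E \<longrightarrow> p u \<ge> real (w {u, v}) \<or> p v \<ge> real (w {u, v}))"

definition pvc_optimal :: "'a set \<Rightarrow> 'a set set \<Rightarrow> ('a set \<Rightarrow> nat) \<Rightarrow> ('a \<Rightarrow> real) \<Rightarrow> bool" where
  "pvc_optimal V E w p \<longleftrightarrow> pvc_feasible V E w p \<and>
     (\<forall>q. pvc_feasible V E w q \<longrightarrow> sum p V \<le> sum q V)"

section \<open>Algorithms\<close>

text \<open>
  Algorithms are programs of a unit-cost random access machine, written as while programs. The
  memory consists of arrays of natural numbers, numbered by naturals; a program can only name
  finitely many of them, a scalar variable is a cell of an array, and indirect addressing is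
  nested reading. The only arithmetic operations are addition and truncated subtraction. With
  them, one step can lengthen the numbers in memory by only a constant number of bits, so this
  machine and a multitape Turing machine simulate each other with polynomial overhead, and classes
  such as \<open>2\<^sup>o\<^sup>(\<^sup>n\<^sup>)\<close> do not depend on the choice (multiplication
  at unit cost would break this). Expressions have constant size in a given program, so they are
  not charged separately.
\<close>

type_synonym memory = "nat \<Rightarrow> nat \<Rightarrow> nat"

datatype expr = Const nat | Read nat expr | Add expr expr | Sub expr expr

fun eval_expr :: "expr \<Rightarrow> memory \<Rightarrow> nat" where
  "eval_expr (Const k) s = k"
| "eval_expr (Read a e) s = s a (eval_expr e s)"
| "eval_expr (Add e1 e2) s = eval_expr e1 s + eval_expr e2 s"
| "eval_expr (Sub e1 e2) s = eval_expr e1 s - eval_expr e2 s"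

text \<open>\<open>Write a e1 e2\<close> stores \<open>e2\<close> in cell \<open>e1\<close> of array \<open>a\<close>; the
  tests of \<open>IfLess\<close> and \<open>WhileLess\<close> are \<open>e1 < e2\<close>.\<close>

datatype prog =
    Skip
  | Write nat expr expr
  | Seq prog prog
  | IfLess expr expr prog prog
  | WhileLess expr expr prog

text \<open>\<open>exec c s T s'\<close>: started in memory \<open>s\<close>, the program \<open>c\<close> halts after
  exactly \<open>T\<close> steps in memory \<open>s'\<close>.\<close>

inductive exec :: "prog \<Rightarrow> memory \<Rightarrow> nat \<Rightarrow> memory \<Rightarrow> bool" where
  Skip: "exec Skip s 1 s"
| Write: "exec (Write a e1 e2) s 1 (s(a := (s a)(eval_expr e1 s := eval_expr e2 s)))"
| Seq: "exec c1 s T1 s1 \<Longrightarrow> exec c2 s1 T2 s2 \<Longrightarrow> exec (Seq c1 c2) s (T1 + T2) s2"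
| IfTrue: "eval_expr e1 s < eval_expr e2 s \<Longrightarrow> exec c1 s T s' \<Longrightarrow>
    exec (IfLess e1 e2 c1 c2) s (T + 1) s'"
| IfFalse: "\<not> eval_expr e1 s < eval_expr e2 s \<Longrightarrow> exec c2 s T s' \<Longrightarrow>
    exec (IfLess e1 e2 c1 c2) s (T + 1) s'"
| WhileFalse: "\<not> eval_expr e1 s < eval_expr e2 s \<Longrightarrow> exec (WhileLess e1 e2 c) s 1 s"
| WhileTrue: "eval_expr e1 s < eval_expr e2 s \<Longrightarrow> exec c s T1 s1 \<Longrightarrow>
    exec (WhileLess e1 e2 c) s1 T2 s2 \<Longrightarrow> exec (WhileLess e1 e2 c) s (T1 + T2 + 1) s2"

inductive_cases exec_SkipE: "exec Skip s T s'"
inductive_cases exec_WriteE: "exec (Write a e1 e2) s T s'"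
inductive_cases exec_SeqE: "exec (Seq c1 c2) s T s'"
inductive_cases exec_IfLessE: "exec (IfLess e1 e2 c1 c2) s T s'"
inductive_cases exec_WhileLessE: "exec (WhileLess e1 e2 c) s T s'"

lemma exec_deterministic:
  "exec c s T s' \<Longrightarrow> exec c s U t \<Longrightarrow> U = T \<and> t = s'"
proof (induction arbitrary: U t rule: exec.induct)
  case (Skip s)
  then show ?case by (rule exec_SkipE) simp
next
  case (Write a e1 e2 s)
  then show ?case by (rule exec_WriteE) simp
next
  case (Seq c1 s T1 s1 c2 T2 s2)
  from Seq.prems obtain U1 t1 U2
    where "exec c1 s U1 t1" and 2: "exec c2 t1 U2 t" and U: "U = U1 + U2"
    by (rule exec_SeqE)
  from this(1) have "U1 = T1 \<and> t1 = s1" by (rule Seq.IH(1))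
  moreover from this 2 have "exec c2 s1 U2 t" by simp
  then have "U2 = T2 \<and> t = s2" by (rule Seq.IH(2))
  ultimately show ?case using U by simp
next
  case (IfTrue e1 s e2 c1 T s' c2)
  from IfTrue.prems IfTrue.hyps(1) obtain U1 where "exec c1 s U1 t" and U: "U = U1 + 1"
    by (auto elim: exec_IfLessE)
  from this(1) have "U1 = T \<and> t = s'" by (rule IfTrue.IH)
  with U show ?case by simp
next
  case (IfFalse e1 s e2 c2 T s' c1)
  from IfFalse.prems IfFalse.hyps(1) obtain U1 where "exec c2 s U1 t" and U: "U = U1 + 1"
    by (auto elim: exec_IfLessE)
  from this(1) have "U1 = T \<and> t = s'" by (rule IfFalse.IH)
  with U show ?case by simp
next
  case (WhileFalse e1 s e2 c)
  from WhileFalse.prems show ?case by (rule exec_WhileLessE) (use WhileFalse.hyps in simp_all)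
next
  case (WhileTrue e1 s e2 c T1 s1 T2 s2)
  from WhileTrue.prems WhileTrue.hyps(1) obtain U1 t1 U2
    where "exec c s U1 t1" and 2: "exec (WhileLess e1 e2 c) t1 U2 t" and U: "U = U1 + U2 + 1"
    by (auto elim: exec_WhileLessE)
  from this(1) have "U1 = T1 \<and> t1 = s1" by (rule WhileTrue.IH(1))
  moreover from this 2 have "exec (WhileLess e1 e2 c) s1 U2 t" by simp
  then have "U2 = T2 \<and> t = s2" by (rule WhileTrue.IH(2))
  ultimately show ?case using U by simp
qed

text \<open>The input is placed at the beginning of array 0; everything else is 0. Output is read off
  array 1.\<close>

definition input_memory :: "nat list \<Rightarrow> memory" where
  "input_memory xs = (\<lambda>a i. if a = 0 \<and> i < length xs then xs ! i else 0)"

section \<open>Solving Power Vertex Cover in time \<open>|V|\<^sup>o\<^sup>(\<^sup>t\<^sup>)\<close>\<close>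

text \<open>Instances are given to a program with vertex set \<open>{..<n}\<close> and as an edge list, in
  which every edge occurs once, in arbitrary order and orientation.\<close>

definition edge_listing :: "'a set set \<Rightarrow> ('a \<times> 'a) list \<Rightarrow> bool" where
  "edge_listing E us \<longleftrightarrow>
     distinct (map (\<lambda>(u, v). {u, v}) us) \<and> set (map (\<lambda>(u, v). {u, v}) us) = E"

definition pvc_code :: "nat \<Rightarrow> (nat \<times> nat) list \<Rightarrow> (nat set \<Rightarrow> nat) \<Rightarrow> nat list" where
  "pvc_code n us w = [n, length us] @ concat (map (\<lambda>(u, v). [u, v, w {u, v}]) us)"

text \<open>
  \<open>C\<close> is the class of instances on which \<open>c\<close> has to be correct and fast. The power of
  vertex \<open>v\<close> is output in cell \<open>v\<close> of array 1; natural numbers suffice, since in an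
  optimal solution every power is 0 or the weight of an incident edge. No time bound is imposed on
  graphs with at most one vertex, where \<open>n\<^sup>f\<^sup>(\<^sup>t\<^sup>) \<le> 1\<close> for every \<open>f\<close>;
  for \<open>n \<ge> 2\<close>, constant factors are absorbed by \<open>f\<close>.
\<close>

definition solves_pvc_on ::
  "(nat set \<Rightarrow> nat set set \<Rightarrow> (nat set \<Rightarrow> nat) \<Rightarrow> bool) \<Rightarrow> prog \<Rightarrow> (nat \<Rightarrow> real) \<Rightarrow> bool" where
  "solves_pvc_on C c f \<longleftrightarrow>
     (\<forall>n E w us. pvc_instance {..<n} E w \<and> C {..<n} E w \<and> edge_listing E us \<longrightarrow>
        (\<exists>T s'. exec c (input_memory (pvc_code n us w)) T s' \<and>
           pvc_optimal {..<n} E w (\<lambda>v. real (s' 1 v)) \<and>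
           (n \<ge> 2 \<longrightarrow> real T \<le> real n powr f (treewidth {..<n} E))))"

definition pvc_in_time_V_pow_little_o_tw ::
  "(nat set \<Rightarrow> nat set set \<Rightarrow> (nat set \<Rightarrow> nat) \<Rightarrow> bool) \<Rightarrow> bool" where
  "pvc_in_time_V_pow_little_o_tw C \<longleftrightarrow>
     (\<exists>c f. f \<in> o(\<lambda>t. real t) \<and> solves_pvc_on C c f)"

definition all_weights :: "'a set \<Rightarrow> 'a set set \<Rightarrow> ('a set \<Rightarrow> nat) \<Rightarrow> bool" where
  "all_weights V E w \<longleftrightarrow> True"

definition weights_bounded :: "nat \<Rightarrow> 'a set \<Rightarrow> 'a set set \<Rightarrow> ('a set \<Rightarrow> nat) \<Rightarrow> bool" where
  "weights_bounded d V E w \<longleftrightarrow> (\<forall>e\<in>E. w e \<le> card V ^ d)"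

section \<open>3-SAT and the Exponential Time Hypothesis\<close>

text \<open>A literal is a variable with its sign. The three literals of a clause need not be distinct,
  so that clauses with one or two literals are covered. Clauses are not repeated in a formula; hence
  there are at most \<open>(2n)\<^sup>3\<close> of them and time can be measured in \<open>n\<close> alone.\<close>

type_synonym literal = "nat \<times> bool"
type_synonym clause = "literal \<times> literal \<times> literal"

definition three_cnf :: "nat \<Rightarrow> clause list \<Rightarrow> bool" where
  "three_cnf n \<phi> \<longleftrightarrow> distinct \<phi> \<and>
     (\<forall>(l1, l2, l3) \<in> set \<phi>. fst l1 < n \<and> fst l2 < n \<and> fst l3 < n)"

definition literal_true :: "(nat \<Rightarrow> bool) \<Rightarrow> literal \<Rightarrow> bool" where
  "literal_true \<alpha> l \<longleftrightarrow> \<alpha> (fst l) = snd l"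

definition satisfiable :: "clause list \<Rightarrow> bool" where
  "satisfiable \<phi> \<longleftrightarrow> (\<exists>\<alpha>. \<forall>(l1, l2, l3) \<in> set \<phi>.
     literal_true \<alpha> l1 \<or> literal_true \<alpha> l2 \<or> literal_true \<alpha> l3)"

definition literal_code :: "literal \<Rightarrow> nat" where
  "literal_code l = 2 * fst l + (if snd l then 1 else 0)"

definition cnf_code :: "nat \<Rightarrow> clause list \<Rightarrow> nat list" where
  "cnf_code n \<phi> = [n, length \<phi>] @
     concat (map (\<lambda>(l1, l2, l3). [literal_code l1, literal_code l2, literal_code l3]) \<phi>)"

definition decides_3sat :: "prog \<Rightarrow> (nat \<Rightarrow> real) \<Rightarrow> bool" where
  "decides_3sat c g \<longleftrightarrow>
     (\<forall>n \<phi>. three_cnf n \<phi> \<longrightarrow>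
        (\<exists>T s'. exec c (input_memory (cnf_code n \<phi>)) T s' \<and>
           (if satisfiable \<phi> then s' 1 0 = 1 else s' 1 0 = 0) \<and>
           real T \<le> 2 powr g n))"

definition ETH :: bool where
  "ETH \<longleftrightarrow> \<not> (\<exists>c g. g \<in> o(\<lambda>n. real n) \<and> decides_3sat c g)"

end

theory Submission
  imports Defs
begin

text \<open>
  Let \<open>b\<close> be about \<open>sqrt n\<close> and split the variables of a 3-CNF formula into \<open>b\<close> groups of
  \<open>b\<close> variables. The assignment to a group is a number \<open>x < 2\<^sup>b\<close>, represented by two selector
  vertices of powers \<open>x\<close> and \<open>2\<^sup>b - 1 - x\<close>. A constraint ``one of six selectors \<open>v\<^sub>i\<close> has power
  at least \<open>t\<^sub>i\<close>'' is a 6-clique with edges of weight \<open>2\<^sup>b\<close>, whose \<open>i\<close>-th vertex is joined to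
  \<open>v\<^sub>i\<close> by an edge of weight \<open>t\<^sub>i\<close>: it costs at least \<open>5 * 2\<^sup>b\<close>, with equality only if one
  clique vertex has power 0, and then its selector covers the edge of weight \<open>t\<^sub>i\<close>.
  Such constraints force the two powers of a group to add up to \<open>2\<^sup>b - 1\<close>, and they exclude, for each clause, each triple of group values that
  falsifies it. Deleting the \<open>2b\<close> selectors leaves disjoint 6-cliques, so the treewidth is at
  most \<open>2b + 5\<close>, and there are \<open>2\<^sup>O\<^sup>(\<^sup>b\<^sup>)\<close> vertices whatever the number of clauses, so no sparsification
  is needed: time \<open>|V|\<^sup>o\<^sup>(\<^sup>t\<^sup>)\<close> is \<open>2\<close> to the power \<open>O(b) o(b) = o(n)\<close>.
\<close>

section \<open>Reasoning about programs and their running time\<close>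

text \<open>A gadget can only ask for a power to be large. That is why a group has two selectors: an
  upper bound on its value \<open>x\<close> is a lower bound on the complement, and
  "\<open>x\<close> differs from \<open>a\<close>" becomes "\<open>x\<close> is at least
  \<open>a + 1\<close> or the complement is at least \<open>2 ^ b - a\<close>". Three literals with
  two alternatives each give the cliques their size six. The obstacle is that constraints are soft:
  a solution may overpay in a gadget, leave its constraint violated and save on selectors. Hence
  violations are counted. Each costs at least 1, and powers of a group that fall short of
  \<open>2 ^ b - 1\<close> by \<open>d\<close> violate at least \<open>d\<close> of its pair
  constraints, so cheating never beats the budget of \<open>5 * 2 ^ b\<close> per gadget plus
  \<open>b * (2 ^ b - 1)\<close>. The machine neither multiplies nor divides, so bits, group numbers
  and products come from tables and running sums.\<close>

definition runs :: "prog \<Rightarrow> memory \<Rightarrow> nat \<Rightarrow> (memory \<Rightarrow> bool) \<Rightarrow> bool" where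
  "runs c s t Q \<longleftrightarrow> (\<exists>T s'. exec c s T s' \<and> T \<le> t \<and> Q s')"

text \<open>Frames are tracked per array and not per cell because cell indices are computed at run
  time. Scalars therefore live in arrays of their own.\<close>

fun writes :: "prog \<Rightarrow> nat set" where
  "writes Skip = {}"
| "writes (Write a e1 e2) = {a}"
| "writes (Seq c1 c2) = writes c1 \<union> writes c2"
| "writes (IfLess e1 e2 c1 c2) = writes c1 \<union> writes c2"
| "writes (WhileLess e1 e2 c) = writes c"

lemma exec_frame: "exec c s T s' \<Longrightarrow> a \<notin> writes c \<Longrightarrow> s' a = s a"
  by (induction rule: exec.induct) auto

lemma runs_mono: "runs c s t Q \<Longrightarrow> t \<le> u \<Longrightarrow> (\<And>s'. Q s' \<Longrightarrow> R s') \<Longrightarrow> runs c s u R"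
  unfolding runs_def by (meson order_trans)

lemma runs_frame:
  "runs c s t Q \<Longrightarrow> runs c s t (\<lambda>s'. Q s' \<and> (\<forall>a. a \<notin> writes c \<longrightarrow> s' a = s a))"
  unfolding runs_def using exec_frame by blast

lemma runs_Skip: "Q s \<Longrightarrow> runs Skip s 1 Q"
  unfolding runs_def using exec.Skip by blast

lemma runs_Write:
  "Q (s(a := (s a)(eval_expr e1 s := eval_expr e2 s))) \<Longrightarrow> runs (Write a e1 e2) s 1 Q"
  unfolding runs_def using exec.Write by blast

lemma runs_Seq:
  "runs c1 s t1 (\<lambda>s1. runs c2 s1 t2 Q) \<Longrightarrow> runs (Seq c1 c2) s (t1 + t2) Q"
  unfolding runs_def by (meson exec.Seq add_mono)

lemma runs_IfLess:
  assumes "eval_expr e1 s < eval_expr e2 s \<Longrightarrow> runs c1 s t Q"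
    and "\<not> eval_expr e1 s < eval_expr e2 s \<Longrightarrow> runs c2 s t Q"
  shows "runs (IfLess e1 e2 c1 c2) s (t + 1) Q"
proof (cases "eval_expr e1 s < eval_expr e2 s")
  case True
  with assms(1) obtain T s' where "exec c1 s T s'" "T \<le> t" "Q s'" by (auto simp: runs_def)
  with True show ?thesis unfolding runs_def
    by (intro exI[of _ "T + 1"] exI[of _ s']) (auto intro: exec.IfTrue[simplified])
next
  case False
  with assms(2) obtain T s' where "exec c2 s T s'" "T \<le> t" "Q s'" by (auto simp: runs_def)
  with False show ?thesis unfolding runs_def
    by (intro exI[of _ "T + 1"] exI[of _ s']) (auto intro: exec.IfFalse[simplified])
qed

text \<open>The invariant carries the iteration number \<open>k\<close>. Since the step has to show
  \<open>k < N\<close> whenever the test succeeds, one premise yields both termination and the time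
  bound; the induction is on \<open>N - k\<close>.\<close>

lemma runs_WhileLess:
  assumes "I k s" "k \<le> N"
    and step: "\<And>k s. I k s \<Longrightarrow> eval_expr e1 s < eval_expr e2 s \<Longrightarrow> k < N \<and> runs c s t (I (Suc k))"
  shows "runs (WhileLess e1 e2 c) s ((N - k) * (t + 1) + 1)
           (\<lambda>s'. \<not> eval_expr e1 s' < eval_expr e2 s' \<and> (\<exists>k\<le>N. I k s'))"
  using assms(1,2)
proof (induction "N - k" arbitrary: k s)
  case 0
  with step[of k s] have "\<not> eval_expr e1 s < eval_expr e2 s" by auto
  with 0 show ?case unfolding runs_def
    by (intro exI[of _ 1] exI[of _ s]) (auto intro: exec.WhileFalse[simplified])
next
  case (Suc d)
  show ?case
  proof (cases "eval_expr e1 s < eval_expr e2 s")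
    case False
    with Suc show ?thesis unfolding runs_def
      by (intro exI[of _ 1] exI[of _ s]) (auto intro!: exec.WhileFalse[simplified])
  next
    case True
    with step[of k s] Suc.prems obtain T1 s1
      where 1: "exec c s T1 s1" "T1 \<le> t" "I (Suc k) s1" and "k < N"
      by (auto simp: runs_def)
    moreover from this Suc.hyps have "d = N - Suc k" "Suc k \<le> N" by auto
    ultimately obtain T2 s2 where 2: "exec (WhileLess e1 e2 c) s1 T2 s2"
      "T2 \<le> (N - Suc k) * (t + 1) + 1" "\<not> eval_expr e1 s2 < eval_expr e2 s2" "\<exists>k\<le>N. I k s2"
      using Suc.hyps(1)[of "Suc k" s1] by (auto simp: runs_def)
    have "N - k = Suc (N - Suc k)" using \<open>k < N\<close> by simp
    then have "T1 + T2 + 1 \<le> (N - k) * (t + 1) + 1" using 1(2) 2(2) by simp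
    with exec.WhileTrue[OF True 1(1) 2(1)] 2 show ?thesis unfolding runs_def by blast
  qed
qed

abbreviation Var :: "nat \<Rightarrow> expr" where "Var a \<equiv> Read a (Const 0)"
abbreviation Set :: "nat \<Rightarrow> expr \<Rightarrow> prog" where "Set a e \<equiv> Write a (Const 0) e"

definition For :: "nat \<Rightarrow> expr \<Rightarrow> prog \<Rightarrow> prog" where
  "For i e c = Seq (Set i (Const 0)) (WhileLess (Var i) e (Seq c (Set i (Add (Var i) (Const 1)))))"

lemma writes_For [simp]: "writes (For i e c) = insert i (writes c)"
  by (auto simp: For_def)

text \<open>The invariant must survive arbitrary changes of the counter array
  (\<open>indep\<close>), and the bound \<open>e\<close>, evaluated anew at each test, must keep its
  value under the writes of the loop (\<open>bound\<close>). Each round costs the body, the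
  increment and the test, hence \<open>t + 2\<close>; initialisation and last test give the final
  2.\<close>

lemma runs_For:
  assumes I0: "I 0 s"
    and indep: "\<And>k s v. I k s \<Longrightarrow> I k (s(i := v))"
    and bound: "\<And>s1. (\<And>a. a \<notin> insert i (writes c) \<Longrightarrow> s1 a = s a) \<Longrightarrow> eval_expr e s1 = N"
    and step: "\<And>k s1. k < N \<Longrightarrow> I k s1 \<Longrightarrow> s1 i 0 = k \<Longrightarrow>
       (\<And>a. a \<notin> insert i (writes c) \<Longrightarrow> s1 a = s a) \<Longrightarrow> runs c s1 t (I (Suc k))"
    and i: "i \<notin> writes c"
  shows "runs (For i e c) s (N * (t + 2) + 2) (I N)"
proof -
  define J where "J k s1 \<longleftrightarrow> I k s1 \<and> s1 i 0 = k \<and> k \<le> N \<and> (\<forall>a. a \<notin> insert i (writes c) \<longrightarrow> s1 a = s a)" for k s1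
  have J0: "J 0 (s(i := (s i)(0 := 0)))" using I0 indep by (auto simp: J_def)
  have "runs (WhileLess (Var i) e (Seq c (Set i (Add (Var i) (Const 1))))) (s(i := (s i)(0 := 0)))
     ((N - 0) * ((t + 1) + 1) + 1) (\<lambda>s'. \<not> eval_expr (Var i) s' < eval_expr e s' \<and> (\<exists>k\<le>N. J k s'))"
  proof (rule runs_WhileLess[where I = J])
    fix k s1 assume J: "J k s1" and lt: "eval_expr (Var i) s1 < eval_expr e s1"
    have b: "eval_expr e s1 = N" using J by (intro bound) (auto simp: J_def)
    then have k: "k < N" using J lt by (auto simp: J_def)
    have "runs c s1 t (\<lambda>s2. I (Suc k) s2 \<and> (\<forall>a. a \<notin> writes c \<longrightarrow> s2 a = s1 a))"
      by (rule runs_frame, rule step) (use k J in \<open>auto simp: J_def\<close>)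
    then have "runs (Seq c (Set i (Add (Var i) (Const 1)))) s1 (t + 1) (J (Suc k))"
      by (intro runs_Seq, elim runs_mono, intro order_refl, intro runs_Write)
        (use k J i indep in \<open>auto simp: J_def\<close>)
    with k show "k < N \<and> runs (Seq c (Set i (Add (Var i) (Const 1)))) s1 (t + 1) (J (Suc k))" by blast
  qed (use J0 in auto)
  then have "runs (WhileLess (Var i) e (Seq c (Set i (Add (Var i) (Const 1))))) (s(i := (s i)(0 := 0)))
     (N * (t + 2) + 1) (I N)"
  proof (rule runs_mono)
    fix s' assume a: "\<not> eval_expr (Var i) s' < eval_expr e s' \<and> (\<exists>k\<le>N. J k s')"
    then obtain k where J: "J k s'" by blast
    then have "eval_expr e s' = N" by (intro bound) (auto simp: J_def)
    with J a have "k = N" by (auto simp: J_def)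
    with J show "I N s'" by (simp add: J_def)
  qed simp
  then have "runs (For i e c) s (1 + (N * (t + 2) + 1)) (I N)"
    unfolding For_def by (intro runs_Seq runs_Write) simp
  then show ?thesis by (simp add: runs_def)
qed

fun reads :: "expr \<Rightarrow> nat set" where
  "reads (Const k) = {}"
| "reads (Read a e) = insert a (reads e)"
| "reads (Add e1 e2) = reads e1 \<union> reads e2"
| "reads (Sub e1 e2) = reads e1 \<union> reads e2"

lemma eval_expr_cong: "(\<And>a. a \<in> reads e \<Longrightarrow> s a = s' a) \<Longrightarrow> eval_expr e s = eval_expr e s'"
  by (induction e) auto

text \<open>The zero padding agrees with \<open>input_memory\<close>, so an array with these
  contents is a legal program input.\<close>

definition list_mem :: "nat list \<Rightarrow> nat \<Rightarrow> nat" where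
  "list_mem ys = (\<lambda>i. if i < length ys then ys ! i else 0)"

lemma list_mem_snoc: "(list_mem ys)(length ys := y) = list_mem (ys @ [y])"
  by (auto simp: list_mem_def fun_eq_iff nth_append)

lemma list_mem_update: "i < length ys \<Longrightarrow> (list_mem ys)(i := y) = list_mem (ys[i := y])"
  by (auto simp: list_mem_def fun_eq_iff nth_list_update)

section \<open>Relocating a program to other arrays\<close>

fun shift_expr :: "nat \<Rightarrow> expr \<Rightarrow> expr" where
  "shift_expr d (Const k) = Const k"
| "shift_expr d (Read a e) = Read (d + a) (shift_expr d e)"
| "shift_expr d (Add e1 e2) = Add (shift_expr d e1) (shift_expr d e2)"
| "shift_expr d (Sub e1 e2) = Sub (shift_expr d e1) (shift_expr d e2)"

fun shift_prog :: "nat \<Rightarrow> prog \<Rightarrow> prog" where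
  "shift_prog d Skip = Skip"
| "shift_prog d (Write a e1 e2) = Write (d + a) (shift_expr d e1) (shift_expr d e2)"
| "shift_prog d (Seq c1 c2) = Seq (shift_prog d c1) (shift_prog d c2)"
| "shift_prog d (IfLess e1 e2 c1 c2) =
     IfLess (shift_expr d e1) (shift_expr d e2) (shift_prog d c1) (shift_prog d c2)"
| "shift_prog d (WhileLess e1 e2 c) = WhileLess (shift_expr d e1) (shift_expr d e2) (shift_prog d c)"

definition stack :: "nat \<Rightarrow> memory \<Rightarrow> memory \<Rightarrow> memory" where
  "stack d s0 s = (\<lambda>a. if a < d then s0 a else s (a - d))"

lemma eval_shift_expr: "eval_expr (shift_expr d e) (stack d s0 s) = eval_expr e s"
  by (induction e) (auto simp: stack_def)

lemma stack_update: "(stack d s0 s)(d + a := f) = stack d s0 (s(a := f))"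
  by (auto simp: stack_def fun_eq_iff)

lemma stack_above: "stack d s0 s (d + a) = s a"
  by (simp add: stack_def)

text \<open>Array numbers are literals in the program text and never computed, so renaming them
  gives a lockstep simulation with the same step count that leaves the arrays below \<open>d\<close>
  untouched.\<close>

lemma exec_shift_prog:
  "exec c s T s' \<Longrightarrow> exec (shift_prog d c) (stack d s0 s) T (stack d s0 s')"
proof (induction rule: exec.induct)
  case (Write a e1 e2 s)
  show ?case
    using exec.Write[of "d + a" "shift_expr d e1" "shift_expr d e2" "stack d s0 s"]
    by (simp add: eval_shift_expr stack_update stack_above del: fun_upd_apply)
qed (auto intro: exec.Skip[simplified] exec.Seq exec.IfTrue[simplified] exec.IfFalse[simplified]
    exec.WhileFalse[simplified] exec.WhileTrue[simplified] simp: eval_shift_expr)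

section \<open>Threshold constraints as Power Vertex Cover instances\<close>

type_synonym weighted_edge = "nat \<times> nat \<times> nat"

abbreviation edge_of :: "weighted_edge \<Rightarrow> nat set" where "edge_of \<equiv> \<lambda>(x, y, t). {x, y}"

text \<open>Each clique vertex lists its selector edge and then its edges to earlier clique
  vertices, 6 + 15 = 21 edges in all. As selectors are numbered below \<open>z\<close>, the larger
  endpoint always comes first, so that unordered edges can be compared as ordered pairs.\<close>

definition gadget_edges :: "nat \<Rightarrow> nat \<Rightarrow> (nat \<times> nat) list \<Rightarrow> weighted_edge list" where
  "gadget_edges M z g =
     concat (map (\<lambda>r. (z + r, g ! r) # map (\<lambda>r'. (z + r, z + r', M)) [0..<r]) [0..<6])"

definition graph_edges :: "nat \<Rightarrow> nat \<Rightarrow> (nat \<times> nat) list list \<Rightarrow> weighted_edge list" where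
  "graph_edges S M gs = concat (map (\<lambda>i. gadget_edges M (S + 6 * i) (gs ! i)) [0..<length gs])"

definition edge_weight :: "weighted_edge list \<Rightarrow> nat set \<Rightarrow> nat" where
  "edge_weight ts e = the (map_of (map (\<lambda>t. (edge_of t, snd (snd t))) ts) e)"

definition constraints_wf :: "nat \<Rightarrow> nat \<Rightarrow> (nat \<times> nat) list list \<Rightarrow> bool" where
  "constraints_wf S M gs \<longleftrightarrow>
     (\<forall>g\<in>set gs. length g = 6 \<and> (\<forall>(v, t)\<in>set g. v < S \<and> 0 < t \<and> t \<le> M))"

definition holds :: "(nat \<Rightarrow> nat) \<Rightarrow> (nat \<times> nat) list \<Rightarrow> bool" where
  "holds p g \<longleftrightarrow> (\<exists>(v, t)\<in>set g. t \<le> p v)"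

lemma graph_edges_snoc:
  "graph_edges S M (gs @ [g]) = graph_edges S M gs @ gadget_edges M (S + 6 * length gs) g"
  by (auto simp: graph_edges_def nth_append intro!: arg_cong[where f = concat])

lemma set_gadget_edges:
  "(x, y, t) \<in> set (gadget_edges M z g) \<longleftrightarrow>
     (\<exists>r<6. x = z + r \<and> ((y, t) = g ! r \<or> (\<exists>r'<r. y = z + r' \<and> t = M)))"
  by (auto simp: gadget_edges_def)

lemma set_graph_edges:
  "(x, y, t) \<in> set (graph_edges S M gs) \<longleftrightarrow>
     (\<exists>i<length gs. \<exists>r<6. x = S + 6 * i + r \<and>
        ((y, t) = gs ! i ! r \<or> (\<exists>r'<r. y = S + 6 * i + r' \<and> t = M)))"
  by (auto simp: graph_edges_def set_gadget_edges Bex_def)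

lemma constraints_wfD:
  assumes "constraints_wf S M gs" "i < length gs" "r < 6" "gs ! i ! r = (v, t)"
  shows "v < S" "0 < t" "t \<le> M"
proof -
  have "length (gs ! i) = 6" using assms by (auto simp: constraints_wf_def)
  then have "(v, t) \<in> set (gs ! i)" using assms nth_mem[of r "gs ! i"] by simp
  with assms show "v < S" "0 < t" "t \<le> M" by (fastforce simp: constraints_wf_def)+
qed

lemma graph_edges_bounds:
  assumes "constraints_wf S M gs" "(x, y, t) \<in> set (graph_edges S M gs)"
  shows "y < x" "S \<le> x" "x < S + 6 * length gs" "t \<le> M" "M > 0 \<Longrightarrow> 0 < t"
proof -
  from assms(2) obtain i r where 1: "i < length gs" "r < 6" "x = S + 6 * i + r"
    "(y, t) = gs ! i ! r \<or> (\<exists>r'<r. y = S + 6 * i + r' \<and> t = M)"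
    by (auto simp: set_graph_edges)
  have "6 * i + r < 6 * length gs" using 1(1,2) by linarith
  then show "x < S + 6 * length gs" using 1 by simp
  show "y < x" "S \<le> x" "t \<le> M" "M > 0 \<Longrightarrow> 0 < t"
    using 1 constraints_wfD[OF assms(1) 1(1,2), of y t] by auto
qed

text \<open>Selector endpoints lie below \<open>z\<close> and clique endpoints do not, so the two
  kinds of edges cannot coincide. What remains is a check of 21 explicit pairs.\<close>

lemma distinct_gadget_edges:
  assumes "length g = 6" "\<forall>(v, t)\<in>set g. v < z"
  shows "distinct (map (\<lambda>(x, y, t). (x, y)) (gadget_edges M z g))"
proof -
  obtain a b c d e f where g: "g = [a, b, c, d, e, f]"
    using assms(1) by (auto simp: numeral_eq_Suc length_Suc_conv)
  with assms(2) have "fst a < z" "fst b < z" "fst c < z" "fst d < z" "fst e < z" "fst f < z" by auto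
  then show ?thesis
    by (auto simp: g gadget_edges_def eval_nat_numeral case_prod_unfold)
qed

text \<open>Different gadgets own disjoint blocks of first endpoints, and \<open>y < x\<close> lets
  an unordered edge determine its ordered pair. Repeated entries of a constraint do no harm, as each
  is attached to another clique vertex.\<close>

lemma distinct_graph_edges:
  assumes "constraints_wf S M gs"
  shows "distinct (map edge_of (graph_edges S M gs))"
proof -
  have "distinct (map (\<lambda>(x, y, t). (x, y)) (graph_edges S M gs))"
    using assms
  proof (induction gs rule: rev_induct)
    case Nil
    show ?case by (simp add: graph_edges_def)
  next
    case (snoc g gs)
    have wf: "constraints_wf S M gs" "length g = 6" "\<forall>(v, t)\<in>set g. v < S"
      using snoc.prems by (auto simp: constraints_wf_def)
    have "distinct (map (\<lambda>(x, y, t). (x, y)) (gadget_edges M (S + 6 * length gs) g))"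
      using wf by (intro distinct_gadget_edges) fastforce+
    moreover have "x < S + 6 * length gs" if "(x, y, t) \<in> set (graph_edges S M gs)" for x y t
      using graph_edges_bounds[OF wf(1) that] by simp
    moreover have "x \<ge> S + 6 * length gs"
      if "(x, y, t) \<in> set (gadget_edges M (S + 6 * length gs) g)" for x y t
      using that by (auto simp: set_gadget_edges)
    ultimately show ?case using snoc.IH[OF wf(1)]
      by (fastforce simp: graph_edges_snoc)
  qed
  then have d: "distinct (graph_edges S M gs)"
    and inj: "inj_on (\<lambda>(x, y, t). (x, y)) (set (graph_edges S M gs))"
    by (simp_all only: distinct_map)
  have "inj_on edge_of (set (graph_edges S M gs))"
  proof (rule inj_onI)
    fix e e' assume m: "e \<in> set (graph_edges S M gs)" "e' \<in> set (graph_edges S M gs)"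
      and eq: "edge_of e = edge_of e'"
    obtain x y t x' y' t' where [simp]: "e = (x, y, t)" "e' = (x', y', t')" by (cases e, cases e')
    have "y < x" "y' < x'" using graph_edges_bounds(1)[OF assms] m by auto
    with eq have "(x, y) = (x', y')" by (auto simp: doubleton_eq_iff)
    with inj_onD[OF inj, of e e'] m show "e = e'" by simp
  qed
  with d show ?thesis by (simp only: distinct_map)
qed

lemma edge_weight_eq:
  assumes "distinct (map edge_of ts)" "(x, y, t) \<in> set ts"
  shows "edge_weight ts {x, y} = t"
proof -
  have "map_of (map (\<lambda>t. (edge_of t, snd (snd t))) ts) {x, y} = Some t"
  proof (rule map_of_is_SomeI)
    show "distinct (map fst (map (\<lambda>t. (edge_of t, snd (snd t))) ts))"
      using assms(1) by (simp add: comp_def)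
    show "({x, y}, t) \<in> set (map (\<lambda>t. (edge_of t, snd (snd t))) ts)"
      using assms(2) by (auto intro!: image_eqI[of _ _ "(x, y, t)"])
  qed
  then show ?thesis by (simp add: edge_weight_def)
qed

lemma pvc_code_edge_weight:
  assumes "distinct (map edge_of ts)"
  shows "pvc_code n (map (\<lambda>(x, y, t). (x, y)) ts) (edge_weight ts) =
     [n, length ts] @ concat (map (\<lambda>(x, y, t). [x, y, t]) ts)"
  unfolding pvc_code_def
  by (auto simp: comp_def edge_weight_eq[OF assms] intro!: arg_cong[where f = concat])

lemma edge_listing_edge_of:
  "distinct (map edge_of ts) \<Longrightarrow>
     edge_listing (edge_of ` set ts) (map (\<lambda>(x, y, t). (x, y)) ts)"
  by (auto simp: edge_listing_def comp_def case_prod_unfold)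

lemma pvc_feasible_edge_weight:
  assumes "distinct (map edge_of ts)"
  shows "pvc_feasible V (edge_of ` set ts) (edge_weight ts) p \<longleftrightarrow>
     (\<forall>v\<in>V. 0 \<le> p v) \<and> (\<forall>(x, y, t)\<in>set ts. real t \<le> p x \<or> real t \<le> p y)"
  (is "?L \<longleftrightarrow> ?R")
proof
  assume L: ?L
  show ?R
  proof (intro conjI ballI, goal_cases)
    case (1 v)
    with L show ?case by (simp add: pvc_feasible_def)
  next
    case (2 e)
    obtain x y t where [simp]: "e = (x, y, t)" by (cases e)
    have "{x, y} \<in> edge_of ` set ts" using 2 by force
    then have "edge_weight ts {x, y} \<le> p x \<or> edge_weight ts {x, y} \<le> p y"
      using L unfolding pvc_feasible_def by blast
    moreover have "edge_weight ts {x, y} = t" using edge_weight_eq[OF assms] 2 by simp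
    ultimately show ?case by simp
  qed
next
  assume R: ?R
  have "real (edge_weight ts {u, v}) \<le> p u \<or> real (edge_weight ts {u, v}) \<le> p v"
    if "{u, v} \<in> edge_of ` set ts" for u v
  proof -
    from that obtain x y t where m: "(x, y, t) \<in> set ts" and e: "{u, v} = {x, y}" by auto
    from R m have "real t \<le> p x \<or> real t \<le> p y" by blast
    moreover have "u = x \<and> v = y \<or> u = y \<and> v = x" using e by (simp add: doubleton_eq_iff)
    ultimately show ?thesis unfolding e edge_weight_eq[OF assms m] by blast
  qed
  with R show ?L by (auto simp: pvc_feasible_def)
qed

section \<open>Cost of a solution\<close>

lemma sum_blocks_of_6:
  fixes p :: "nat \<Rightarrow> 'a::comm_monoid_add"
  shows "sum p {..<S + 6 * G} = sum p {..<S} + (\<Sum>i<G. \<Sum>r<6. p (S + 6 * i + r))"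
proof (induction G)
  case (Suc G)
  have "sum p {..<S + 6 * Suc G} = sum p {..<S + 6 * G} + (\<Sum>r<6. p (S + 6 * G + r))"
    by (simp add: eval_nat_numeral add_ac)
  with Suc show ?case by (simp add: add.assoc)
qed simp

text \<open>Two clique vertices below \<open>M\<close> would leave their common edge uncovered, so
  at least five reach \<open>M\<close>. If the sixth is below \<open>M\<close>, it can have power 0
  only if its selector covers its outer edge; otherwise it adds the missing 1. If none is below
  \<open>M\<close>, the cost is at least \<open>6 * M\<close>, which is also enough.\<close>

lemma gadget_cost:
  fixes p :: "nat \<Rightarrow> nat"
  assumes "length g = 6" "\<forall>(v, t)\<in>set g. 0 < t \<and> t \<le> M" "0 < M"
    and p: "\<And>x y t. (x, y, t) \<in> set (gadget_edges M z g) \<Longrightarrow> t \<le> p x \<or> t \<le> p y"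
  shows "5 * M + (if holds p g then 0 else 1) \<le> (\<Sum>r<6. p (z + r))"
proof (cases "\<exists>r<6. p (z + r) < M")
  case True
  then obtain r where r: "r < 6" "p (z + r) < M" by blast
  have o: "M \<le> p (z + r')" if "r' < 6" "r' \<noteq> r" for r'
  proof (cases "r' < r")
    case True
    then show ?thesis using p[of "z + r" "z + r'" M] r that by (auto simp: set_gadget_edges)
  next
    case False
    then show ?thesis using p[of "z + r'" "z + r" M] r that by (auto simp: set_gadget_edges)
  qed
  have "5 * M = (\<Sum>r'\<in>{..<6} - {r}. M)" using r by simp
  also have "\<dots> \<le> (\<Sum>r'\<in>{..<6} - {r}. p (z + r'))" using o by (intro sum_mono) auto
  finally have "5 * M + p (z + r) \<le> (\<Sum>r<6. p (z + r))"
    using r by (simp add: sum.remove[of "{..<6}" r])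
  moreover have "1 \<le> p (z + r)" if "\<not> holds p g"
  proof -
    obtain v t where vt: "g ! r = (v, t)" by (cases "g ! r")
    have m: "(v, t) \<in> set g" using vt r assms(1) by (metis nth_mem)
    have "t \<le> p (z + r) \<or> t \<le> p v"
      using vt r by (intro p) (auto simp: set_gadget_edges)
    with that m assms(2) show ?thesis by (fastforce simp: holds_def)
  qed
  ultimately show ?thesis by auto
next
  case False
  have "6 * M = (\<Sum>r<6::nat. M)" by simp
  also have "\<dots> \<le> (\<Sum>r<6. p (z + r))" using False by (intro sum_mono) (metis lessThan_iff not_less)
  finally show ?thesis using assms(3) by auto
qed

text \<open>Feasibility does not force constraints to hold, since an overpaid gadget may ignore its
  constraint. The count of violated constraints records what this costs, to be traded against
  savings on the selectors.\<close>

lemma cost_lower_bound: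
  fixes p :: "nat \<Rightarrow> nat"
  assumes wf: "constraints_wf S M gs" and "0 < M"
    and p: "\<And>x y t. (x, y, t) \<in> set (graph_edges S M gs) \<Longrightarrow> t \<le> p x \<or> t \<le> p y"
  shows "sum p {..<S} + 5 * M * length gs + length (filter (\<lambda>g. \<not> holds p g) gs)
      \<le> sum p {..<S + 6 * length gs}"
proof -
  have "(\<Sum>i<length gs. 5 * M + (if holds p (gs ! i) then 0 else 1))
      \<le> (\<Sum>i<length gs. \<Sum>r<6. p (S + 6 * i + r))"
  proof (intro sum_mono gadget_cost)
    fix i assume i: "i \<in> {..<length gs}"
    then have "gs ! i \<in> set gs" by simp
    then show "length (gs ! i) = 6" "\<forall>(v, t)\<in>set (gs ! i). 0 < t \<and> t \<le> M"
      using wf by (auto simp: constraints_wf_def)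
    show "t \<le> p x \<or> t \<le> p y" if "(x, y, t) \<in> set (gadget_edges M (S + 6 * i) (gs ! i))" for x y t
      using p[of x y t] that i by (auto simp: set_gadget_edges set_graph_edges)
  qed (rule \<open>0 < M\<close>)
  moreover have "length (filter (\<lambda>g. \<not> holds p g) gs) =
      (\<Sum>i<length gs. if holds p (gs ! i) then 0 else 1)"
    by (induction gs rule: rev_induct) (simp_all add: nth_append)
  ultimately show ?thesis by (simp add: sum_blocks_of_6 sum.distrib mult.commute[of "length gs"])
qed

text \<open>In each gadget one clique vertex whose threshold is met by its selector gets power 0 and
  the other five get \<open>M\<close>, which attains the bound of
  \<open>cost_lower_bound\<close>.\<close>

lemma exists_solution:
  assumes wf: "constraints_wf S M gs" and X: "\<And>g. g \<in> set gs \<Longrightarrow> holds X g"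
  obtains q where
    "\<And>x y t. (x, y, t) \<in> set (graph_edges S M gs) \<Longrightarrow> t \<le> q x \<or> t \<le> (q y :: nat)"
    "sum q {..<S + 6 * length gs} = sum X {..<S} + 5 * M * length gs"
proof -
  have "\<forall>i<length gs. \<exists>r<6. snd (gs ! i ! r) \<le> X (fst (gs ! i ! r))"
  proof (intro allI impI)
    fix i assume i: "i < length gs"
    have l: "length (gs ! i) = 6" using wf i by (auto simp: constraints_wf_def)
    have "holds X (gs ! i)" using X i by auto
    then obtain v t where "(v, t) \<in> set (gs ! i)" "t \<le> X v" by (auto simp: holds_def)
    with l show "\<exists>r<6. snd (gs ! i ! r) \<le> X (fst (gs ! i ! r))"
      by (metis in_set_conv_nth fst_conv snd_conv)
  qed
  then obtain sel where sel: "\<And>i. i < length gs \<Longrightarrow> sel i < (6::nat)"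
    "\<And>i. i < length gs \<Longrightarrow> snd (gs ! i ! sel i) \<le> X (fst (gs ! i ! sel i))"
    by metis
  define q where "q v = (if v < S then X v else
     if (v - S) mod 6 = sel ((v - S) div 6) then 0 else M)" for v
  have q1: "q (S + 6 * i + r) = (if r = sel i then 0 else M)" if "r < 6" for i r
    using that by (simp add: q_def add.assoc)
  have "t \<le> q x \<or> t \<le> q y" if xyt: "(x, y, t) \<in> set (graph_edges S M gs)" for x y t
  proof -
    from xyt obtain i r where 1: "i < length gs" "r < 6" "x = S + 6 * i + r"
      "(y, t) = gs ! i ! r \<or> (\<exists>r'<r. y = S + 6 * i + r' \<and> t = M)"
      by (auto simp: set_graph_edges)
    from 1(4) show ?thesis
    proof
      assume yt: "(y, t) = gs ! i ! r"
      then have "y < S" "t \<le> M" using constraints_wfD[OF wf 1(1,2)] by (metis)+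
      then show ?thesis using 1 q1 sel(2)[OF 1(1)] yt
        by (cases "r = sel i") (auto simp: q_def[of y] dest!: sym[of "(y, t)"])
    next
      assume "\<exists>r'<r. y = S + 6 * i + r' \<and> t = M"
      then obtain r' where "r' < r" "y = S + 6 * i + r'" "t = M" by blast
      then show ?thesis using 1 q1[of r i] q1[of r' i] by auto
    qed
  qed
  moreover have "sum q {..<S + 6 * length gs} = sum X {..<S} + 5 * M * length gs"
  proof -
    have "(\<Sum>r<6. q (S + 6 * i + r)) = 5 * M" if "i < length gs" for i
    proof -
      have "(\<Sum>r<6. q (S + 6 * i + r)) = (\<Sum>r\<in>{..<6} - {sel i}. M)"
        by (rule sum.mono_neutral_cong_right) (auto simp: q1)
      then show ?thesis using sel(1)[OF that] by simp
    qed
    moreover have "sum q {..<S} = sum X {..<S}" by (simp add: q_def)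
    ultimately show ?thesis by (simp add: sum_blocks_of_6)
  qed
  ultimately show ?thesis by (rule that)
qed

section \<open>A tree decomposition\<close>

text \<open>Every edge contains 0. Two consecutive edges of a cycle can both do so only if their
  common vertex is 0, and then the edge after them misses it.\<close>

lemma star_is_tree:
  fixes m :: nat
  assumes m: "0 < m"
  shows "is_tree {..<m} ((\<lambda>i. {0, i}) ` {1..<m})"
proof -
  let ?F = "(\<lambda>i. {0::nat, i}) ` {1..<m}" and ?R = "{(a, b). a \<in> {..<m} \<and> b \<in> {..<m} \<and> {a, b} \<in> (\<lambda>i. {0::nat, i}) ` {1..<m}}"
  have "(x, 0) \<in> ?R\<^sup>*" "(0, x) \<in> ?R\<^sup>*" if "x < m" for x
  proof -
    have "x = 0 \<or> (x, 0) \<in> ?R \<and> (0, x) \<in> ?R" using that m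
      by (auto simp: insert_commute image_iff intro!: bexI[of _ x])
    then show "(x, 0) \<in> ?R\<^sup>*" "(0, x) \<in> ?R\<^sup>*" by auto
  qed
  then have "connected_in ?F {..<m}"
    unfolding connected_in_def by (meson lessThan_iff rtrancl_trans)
  moreover have "\<not> is_cycle ?F vs" for vs
  proof
    assume c: "is_cycle ?F vs"
    have E: "{vs ! i, vs ! (Suc i mod length vs)} \<in> ?F" if "i < length vs" for i
      using c that by (auto simp: is_cycle_def)
    have l: "3 \<le> length vs" "distinct vs" using c by (auto simp: is_cycle_def)
    have Z: "vs ! i = 0 \<or> vs ! (Suc i mod length vs) = 0" if "i < length vs" for i
      using E[OF that] by (auto simp: doubleton_eq_iff)
    \<comment> \<open>Position 3 wraps around to 0 in a triangle and lies beyond 2 otherwise; either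
      way it is not position 1.\<close>
    have m3: "Suc 2 mod length vs \<noteq> 1" using l(1)
      by (cases "length vs = 3") (simp_all add: numeral_3_eq_3 numeral_2_eq_2)
    have lt: "Suc 2 mod length vs < length vs" using l(1) by (intro mod_less_divisor) linarith
    have "vs ! 0 = 0 \<or> vs ! 1 = 0" using Z[of 0] l by (cases "length vs") auto
    moreover have "vs ! 1 = 0 \<or> vs ! 2 = 0" using Z[of 1] l by (simp add: numeral_2_eq_2)
    moreover have "vs ! 2 = 0 \<or> vs ! (Suc 2 mod length vs) = 0" using Z[of 2] l by simp
    moreover have "vs ! 0 \<noteq> vs ! 1" "vs ! 1 \<noteq> vs ! 2" "vs ! 0 \<noteq> vs ! 2"
      "vs ! (Suc 2 mod length vs) \<noteq> vs ! 1"
    proof -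
      have "0 < length vs" "1 < length vs" "2 < length vs" using l(1) by linarith+
      then show "vs ! 0 \<noteq> vs ! 1" "vs ! 1 \<noteq> vs ! 2" "vs ! 0 \<noteq> vs ! 2"
        "vs ! (Suc 2 mod length vs) \<noteq> vs ! 1"
        using m3 lt by (simp_all only: nth_eq_iff_index_eq[OF l(2)]) simp_all
    qed
    ultimately show False by auto
  qed
  moreover have "simple_graph {..<m} ?F"
    unfolding simple_graph_def by (force intro: exI[of _ 0])
  ultimately show ?thesis using m by (auto simp: is_tree_def)
qed

lemma treewidth_le:
  assumes "tree_decomposition V E I F B" "\<And>i. i \<in> I \<Longrightarrow> card (B i) \<le> k + 1"
  shows "treewidth V E \<le> k"
  unfolding treewidth_def using assms by (intro Least_le) blast

text \<open>The bag of node \<open>i\<close> consists of all selectors and gadget \<open>i\<close>.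
  Selectors lie in every bag and a clique vertex in just one, so any tree on the gadgets would do,
  and a star is taken. Bags have \<open>S + 6\<close> vertices, and treewidth subtracts one.\<close>

lemma treewidth_graph_edges:
  assumes wf: "constraints_wf S M gs" and "gs \<noteq> []"
  shows "treewidth {..<S + 6 * length gs} (edge_of ` set (graph_edges S M gs)) \<le> S + 5"
proof (rule treewidth_le)
  let ?m = "length gs"
  let ?F = "(\<lambda>i. {0, i}) ` {1..<?m}" and ?B = "\<lambda>i. {..<S} \<union> {S + 6 * i..<S + 6 * i + 6}"
  show "tree_decomposition {..<S + 6 * ?m} (edge_of ` set (graph_edges S M gs)) {..<?m} ?F ?B"
    unfolding tree_decomposition_def
  proof (intro conjI ballI)
    show t: "is_tree {..<?m} ?F" using assms by (intro star_is_tree) simp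
    show "?B i \<subseteq> {..<S + 6 * ?m}" if "i \<in> {..<?m}" for i using that by auto
    have own: "v \<in> {S + 6 * i..<S + 6 * i + 6} \<longleftrightarrow> i = (v - S) div 6" if "S \<le> v" for v i
      using that by auto
    show "\<exists>i\<in>{..<?m}. v \<in> ?B i" if "v \<in> {..<S + 6 * ?m}" for v
    proof (cases "v < S")
      case True
      with assms(2) show ?thesis by (intro bexI[of _ 0]) auto
    next
      case False
      with that own[of v "(v - S) div 6"] show ?thesis
        by (intro bexI[of _ "(v - S) div 6"]) auto
    qed
    show "\<exists>i\<in>{..<?m}. e \<subseteq> ?B i" if e: "e \<in> edge_of ` set (graph_edges S M gs)" for e
    proof -
      from e obtain x y t where xyt: "(x, y, t) \<in> set (graph_edges S M gs)" "e = {x, y}" by auto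
      then obtain i r where 1: "i < length gs" "r < 6" "x = S + 6 * i + r"
        "(y, t) = gs ! i ! r \<or> (\<exists>r'<r. y = S + 6 * i + r' \<and> t = M)"
        by (auto simp: set_graph_edges)
      then have "e \<subseteq> ?B i" using constraints_wfD[OF wf 1(1,2), of y t] xyt by auto
      with 1 show ?thesis by blast
    qed
    show "connected_in ?F {i \<in> {..<?m}. v \<in> ?B i}" if "v \<in> {..<S + 6 * ?m}" for v
    proof (cases "v < S")
      case True
      then have "{i \<in> {..<?m}. v \<in> ?B i} = {..<?m}" by auto
      with t show ?thesis by (simp only: is_tree_def)
    next
      case False
      then have "{i \<in> {..<?m}. v \<in> ?B i} \<subseteq> {(v - S) div 6}" using own[of v] by auto
      then have "x = y" if "x \<in> {i \<in> {..<?m}. v \<in> ?B i}" "y \<in> {i \<in> {..<?m}. v \<in> ?B i}" for x y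
        using that by blast
      then show ?thesis unfolding connected_in_def by (metis (no_types, lifting) rtrancl.rtrancl_refl)
    qed
  qed
  show "card (?B i) \<le> S + 5 + 1" for i
    by (rule order_trans[OF card_Un_le]) simp
qed

section \<open>3-SAT as a system of threshold constraints\<close>

text \<open>With \<open>N = 2 ^ b - 1\<close> it says that the first power exceeds \<open>x\<close>
  or the second is at least \<open>N - x\<close>. Over all \<open>x < N\<close> this means that the
  two powers sum to at least \<open>N\<close>. Each alternative is tripled to fill the six slots of
  the uniform gadget.\<close>

definition pair_constraint :: "nat \<Rightarrow> nat \<Rightarrow> nat \<Rightarrow> (nat \<times> nat) list" where
  "pair_constraint N j x =
     [(2 * j, x + 1), (2 * j, x + 1), (2 * j, x + 1),
      (2 * j + 1, N - x), (2 * j + 1, N - x), (2 * j + 1, N - x)]"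

text \<open>Variable \<open>v\<close> is bit \<open>v mod b\<close> of group \<open>v div b\<close>, whose selectors are \<open>2 * (v div b)\<close> and its
  successor; here \<open>l\<close> is a literal code, hence \<open>v = l div 2\<close>.\<close>

definition falsifies :: "nat \<Rightarrow> nat \<Rightarrow> nat \<Rightarrow> bool" where
  "falsifies b l a \<longleftrightarrow> bit a (l div 2 mod b) \<noteq> odd l"

definition selector :: "nat \<Rightarrow> nat \<Rightarrow> nat" where
  "selector b l = 2 * (l div 2 div b)"

text \<open>When the powers of a group are \<open>x\<close> and \<open>2 ^ b - 1 - x\<close>, its
  two entries for \<open>a\<close> say \<open>x > a\<close> and \<open>x < a\<close>. So the six
  together exclude exactly the triple \<open>(a1, a2, a3)\<close>.\<close>

definition clause_constraint :: "nat \<Rightarrow> nat \<times> nat \<times> nat \<Rightarrow> nat \<Rightarrow> nat \<Rightarrow> nat \<Rightarrow> (nat \<times> nat) list" where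
  "clause_constraint b = (\<lambda>(l1, l2, l3) a1 a2 a3.
     [(selector b l1, a1 + 1), (selector b l1 + 1, 2 ^ b - a1),
      (selector b l2, a2 + 1), (selector b l2 + 1, 2 ^ b - a2),
      (selector b l3, a3 + 1), (selector b l3 + 1, 2 ^ b - a3)])"

text \<open>The index stops before \<open>2 ^ b - 1\<close>, where a threshold would be 0 and no
  legal weight. The nested \<open>concat\<close> and \<open>map\<close> mirror the
  \<open>For\<close> loops of the emitting program, in the form that \<open>runs_For_emitted\<close>
  produces.\<close>

definition pair_constraints :: "nat \<Rightarrow> nat \<Rightarrow> (nat \<times> nat) list list" where
  "pair_constraints b j = concat (map (\<lambda>x. [pair_constraint (2 ^ b - 1) j x]) [0..<2 ^ b - 1])"

text \<open>Literals of a clause may share a group; a triple that gives this group two values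
  excludes no assignment, so consistency is not tested.\<close>

definition clause_constraints :: "nat \<Rightarrow> nat \<times> nat \<times> nat \<Rightarrow> (nat \<times> nat) list list" where
  "clause_constraints b = (\<lambda>(l1, l2, l3).
     concat (map (\<lambda>a1. concat (map (\<lambda>a2. concat (map (\<lambda>a3.
       if falsifies b l1 a1 \<and> falsifies b l2 a2 \<and> falsifies b l3 a3
       then [clause_constraint b (l1, l2, l3) a1 a2 a3] else [])
     [0..<2 ^ b])) [0..<2 ^ b])) [0..<2 ^ b]))"

definition constraints :: "nat \<Rightarrow> (nat \<times> nat \<times> nat) list \<Rightarrow> (nat \<times> nat) list list" where
  "constraints b cs =
     concat (map (pair_constraints b) [0..<b]) @ concat (map (clause_constraints b) cs)"

abbreviation clause_codes :: "clause \<Rightarrow> nat \<times> nat \<times> nat" where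
  "clause_codes \<equiv> \<lambda>(l1, l2, l3). (literal_code l1, literal_code l2, literal_code l3)"

lemma literal_code_simps [simp]:
  "literal_code l div 2 = fst l" "odd (literal_code l) = snd l" "even (literal_code l) = (\<not> snd l)"
  by (auto simp: literal_code_def)

lemma set_pair_constraints:
  "set (pair_constraints b j) = pair_constraint (2 ^ b - 1) j ` {..<2 ^ b - 1}"
  by (auto simp: pair_constraints_def)

lemma set_clause_constraints:
  "set (clause_constraints b (l1, l2, l3)) =
     {clause_constraint b (l1, l2, l3) a1 a2 a3 | a1 a2 a3. a1 < 2 ^ b \<and> a2 < 2 ^ b \<and> a3 < 2 ^ b \<and>
        falsifies b l1 a1 \<and> falsifies b l2 a2 \<and> falsifies b l3 a3}"
  by (fastforce simp: clause_constraints_def)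

lemma in_set_constraints:
  "g \<in> set (constraints b cs) \<longleftrightarrow>
     (\<exists>j<b. g \<in> set (pair_constraints b j)) \<or> (\<exists>c\<in>set cs. g \<in> set (clause_constraints b c))"
  by (auto simp: constraints_def)

lemma constraints_wf_constraints:
  assumes "\<And>l1 l2 l3. (l1, l2, l3) \<in> set cs \<Longrightarrow> l1 < 2 * b * b \<and> l2 < 2 * b * b \<and> l3 < 2 * b * b"
  shows "constraints_wf (2 * b) (2 ^ b) (constraints b cs)"
proof -
  have sel: "selector b l < 2 * b" "Suc (selector b l) < 2 * b" if "l < 2 * b * b" for l
  proof -
    have "l div 2 div b < b" using that by (simp add: less_mult_imp_div_less algebra_simps)
    then show "selector b l < 2 * b" "Suc (selector b l) < 2 * b" by (auto simp: selector_def)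
  qed
  have "length g = 6 \<and> (\<forall>(v, t)\<in>set g. v < 2 * b \<and> 0 < t \<and> t \<le> 2 ^ b)"
    if "g \<in> set (pair_constraints b j)" "j < b" for g j
    using that by (auto simp: set_pair_constraints pair_constraint_def)
  moreover have "length g = 6 \<and> (\<forall>(v, t)\<in>set g. v < 2 * b \<and> 0 < t \<and> t \<le> 2 ^ b)"
    if "g \<in> set (clause_constraints b c)" "c \<in> set cs" for g c
  proof (cases c)
    case (fields l1 l2 l3)
    with assms that have "l1 < 2 * b * b" "l2 < 2 * b * b" "l3 < 2 * b * b" by blast+
    with that show ?thesis
      by (auto simp: fields set_clause_constraints clause_constraint_def sel)
  qed
  ultimately have "length g = 6 \<and> (\<forall>(v, t)\<in>set g. v < 2 * b \<and> 0 < t \<and> t \<le> 2 ^ b)"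
    if "g \<in> set (constraints b cs)" for g
    using that unfolding in_set_constraints by blast
  then show ?thesis unfolding constraints_wf_def by blast
qed

lemma length_concat_map_upt:
  "length (concat (map f [0..<n])) = (\<Sum>i<n. length (f i))"
  by (induction n) auto

lemma length_concat_le:
  "(\<And>x. x \<in> set xs \<Longrightarrow> length (f x) \<le> k) \<Longrightarrow> length (concat (map f xs)) \<le> length xs * k"
  by (induction xs) (auto simp: add_mono)

lemma length_constraints_le: "length (constraints b cs) \<le> b * 2 ^ b + length cs * 2 ^ (3 * b)"
proof -
  have "length (pair_constraints b j) \<le> 2 ^ b" for j
    by (simp add: pair_constraints_def length_concat_map_upt)
  then have "length (concat (map (pair_constraints b) [0..<b])) \<le> length [0..<b] * 2 ^ b"
    by (intro length_concat_le)
  moreover have "length (clause_constraints b c) \<le> 2 ^ (3 * b)" for c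
  proof -
    obtain l1 l2 l3 where c: "c = (l1, l2, l3)" by (cases c)
    have "length (clause_constraints b c) \<le> length [0..<2 ^ b] * (length [0..<2 ^ b :: nat] * (length [0..<2 ^ b :: nat] * 1))"
      unfolding c clause_constraints_def case_prod_conv by (intro length_concat_le) simp
    also have "\<dots> = 2 ^ (3 * b)" by (simp add: power_add[symmetric] numeral_3_eq_3)
    finally show ?thesis .
  qed
  then have "length (concat (map (clause_constraints b) cs)) \<le> length cs * 2 ^ (3 * b)"
    by (intro length_concat_le)
  ultimately show ?thesis by (simp add: constraints_def)
qed

lemma length_constraints_ge: "b * (2 ^ b - 1) \<le> length (constraints b cs)"
  by (simp add: constraints_def length_concat_map_upt pair_constraints_def)

lemma sum_pairs: "sum X {..<2 * b} = (\<Sum>j<b. X (2 * j) + X (2 * j + 1 :: nat) :: nat)"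
  by (induction b) auto

text \<open>\<open>x j\<close> packs the truth values of group \<open>j\<close> into a number.
  Listed triples falsify all three literals of their clause, so under a satisfying assignment the
  actual group values are never a listed triple.\<close>

lemma satisfiable_imp_holds:
  assumes "satisfiable \<phi>" and "three_cnf n \<phi>" and "0 < b"
  obtains X where "\<And>g. g \<in> set (constraints b (map clause_codes \<phi>)) \<Longrightarrow> holds X g"
    "sum X {..<2 * b} = b * (2 ^ b - 1)"
proof -
  from assms(1) obtain \<alpha> where \<alpha>: "\<And>l1 l2 l3. (l1, l2, l3) \<in> set \<phi> \<Longrightarrow>
    literal_true \<alpha> l1 \<or> literal_true \<alpha> l2 \<or> literal_true \<alpha> l3"
    unfolding satisfiable_def by blast
  define x :: "nat \<Rightarrow> nat" where "x j = horner_sum of_bool 2 (map (\<lambda>i. \<alpha> (j * b + i)) [0..<b])" for j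
  have x_less: "x j < 2 ^ b" for j
    using horner_sum_of_bool_2_less[of "map (\<lambda>i. \<alpha> (j * b + i)) [0..<b]", where ?'a = nat]
    by (simp add: x_def)
  have bit_x: "bit (x j) i \<longleftrightarrow> \<alpha> (j * b + i)" if "i < b" for i j
    using that by (simp add: x_def bit_horner_sum_bit_iff)
  define X where "X v = (if even v then x (v div 2) else 2 ^ b - 1 - x (v div 2))" for v
  have X: "X (2 * j) = x j" "X (Suc (2 * j)) = 2 ^ b - 1 - x j" for j by (auto simp: X_def)
  have pair: "holds X (pair_constraint (2 ^ b - 1) j y)" for j y
    by (auto simp: holds_def pair_constraint_def X)
  have clause: "holds X (clause_constraint b (l1, l2, l3) a1 a2 a3)"
    if "a1 \<noteq> x (l1 div 2 div b) \<or> a2 \<noteq> x (l2 div 2 div b) \<or> a3 \<noteq> x (l3 div 2 div b)"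
    for l1 l2 l3 a1 a2 a3
    using that x_less by (auto simp: holds_def clause_constraint_def X selector_def neq_iff Suc_le_eq)
  have fals: "\<not> literal_true \<alpha> l" if "falsifies b (literal_code l) (x (fst l div b))" for l
    using that assms(3) by (simp add: falsifies_def bit_x literal_true_def div_mod_decomp[symmetric])
  have "holds X g" if g: "g \<in> set (constraints b (map clause_codes \<phi>))" for g
  proof -
    from g consider j where "g \<in> set (pair_constraints b j)"
      | l1 l2 l3 where "(l1, l2, l3) \<in> set \<phi>"
        "g \<in> set (clause_constraints b (literal_code l1, literal_code l2, literal_code l3))"
      by (auto simp: constraints_def)
    then show ?thesis
    proof cases
      case 1
      with pair show ?thesis by (auto simp: set_pair_constraints)
    next
      case 2
      then obtain a1 a2 a3 where
        g: "g = clause_constraint b (literal_code l1, literal_code l2, literal_code l3) a1 a2 a3"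
        and f: "falsifies b (literal_code l1) a1" "falsifies b (literal_code l2) a2"
          "falsifies b (literal_code l3) a3"
        by (auto simp: set_clause_constraints)
      have "a1 \<noteq> x (fst l1 div b) \<or> a2 \<noteq> x (fst l2 div b) \<or> a3 \<noteq> x (fst l3 div b)"
        using \<alpha>[OF 2(1)] fals f by blast
      then show ?thesis unfolding g by (intro clause) simp
    qed
  qed
  moreover have "sum X {..<2 * b} = b * (2 ^ b - 1)"
  proof -
    have "X (2 * j) + X (2 * j + 1) = 2 ^ b - 1" for j
      using x_less[of j] by (simp add: X)
    then show ?thesis by (simp add: sum_pairs)
  qed
  ultimately show ?thesis by (rule that)
qed

text \<open>Per group, powers plus violated pair constraints amount to at least \<open>N\<close>.
  The budget \<open>b * N\<close> thus leaves no room: every group attains \<open>N\<close> exactly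
  and no clause constraint is violated. The assignment is read off the first selector of each
  group.\<close>

lemma cheap_imp_satisfiable:
  assumes "0 < b" and three: "three_cnf n \<phi>" "n \<le> b * b"
    and le: "sum p {..<2 * b} + length (filter (\<lambda>g. \<not> holds p g) (constraints b (map clause_codes \<phi>)))
       \<le> b * (2 ^ b - 1)"
  shows "satisfiable \<phi>"
proof -
  define N :: nat where "N = 2 ^ b - 1"
  define viol where "viol j = length (filter (\<lambda>g. \<not> holds p g) (pair_constraints b j))" for j
  \<comment> \<open>The violated constraints are those with \<open>x\<close> from
    \<open>p (2 * j)\<close> up to but excluding \<open>N - p (2 * j + 1)\<close>; their number is
    the shortfall of the two powers.\<close>
  have ge: "N \<le> p (2 * j) + p (2 * j + 1) + viol j" for j
  proof -
    have "viol j = (\<Sum>x<N. if holds p (pair_constraint N j x) then 0 else 1)"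
      unfolding viol_def pair_constraints_def N_def filter_concat
      by (simp add: length_concat_map_upt comp_def if_distrib cong: if_cong) (intro sum.cong; simp)
    also have "\<dots> \<ge> (\<Sum>x\<in>{p (2 * j)..<N - p (2 * j + 1)}. 1)"
    proof (rule order_trans[OF _ sum_mono2])
      show "(\<Sum>x\<in>{p (2 * j)..<N - p (2 * j + 1)}. 1)
        \<le> (\<Sum>x\<in>{p (2 * j)..<N - p (2 * j + 1)}. if holds p (pair_constraint N j x) then 0 else 1 :: nat)"
        by (rule sum_mono) (auto simp: holds_def pair_constraint_def)
    qed auto
    finally show ?thesis by simp
  qed
  have v: "length (filter (\<lambda>g. \<not> holds p g) (constraints b (map clause_codes \<phi>))) =
    (\<Sum>j<b. viol j) + length (filter (\<lambda>g. \<not> holds p g) (concat (map (clause_constraints b) (map clause_codes \<phi>))))"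
    (is "_ = _ + ?w")
    by (simp add: constraints_def filter_concat comp_def length_concat_map_upt viol_def)
  have s: "(\<Sum>j<b. p (2 * j) + p (2 * j + 1) + viol j) + ?w \<le> (\<Sum>j<b. N)"
    using le unfolding v sum_pairs by (simp add: sum.distrib N_def)
  have s': "(\<Sum>j<b. N) \<le> (\<Sum>j<b. p (2 * j) + p (2 * j + 1) + viol j)"
    by (intro sum_mono ge)
  have w: "?w = 0" using s s' by linarith
  have "p (2 * j) + p (2 * j + 1) + viol j = N" if "j < b" for j
    using sum_mono_inv[of "\<lambda>_. N" "{..<b}" "\<lambda>j. p (2 * j) + p (2 * j + 1) + viol j" j] s s' ge that by auto
  \<comment> \<open>Pair constraints may still be violated here, but what counts is
    \<open>p (2 * j) + p (2 * j + 1) < 2 ^ b\<close>: the second selector is too small to reach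
    \<open>2 ^ b - p (2 * j)\<close>.\<close>
  then have N: "p (2 * j) + p (2 * j + 1) \<le> N" if "j < b" for j using that by fastforce
  have "N < 2 ^ b" by (simp add: N_def)
  define \<alpha> where "\<alpha> v = bit (p (2 * (v div b))) (v mod b)" for v
  have "literal_true \<alpha> l1 \<or> literal_true \<alpha> l2 \<or> literal_true \<alpha> l3" if c: "(l1, l2, l3) \<in> set \<phi>" for l1 l2 l3
  proof (rule ccontr)
    assume "\<not> ?thesis"
    then have nt: "\<not> literal_true \<alpha> l1" "\<not> literal_true \<alpha> l2" "\<not> literal_true \<alpha> l3" by auto
    have f: "falsifies b (literal_code l) (p (selector b (literal_code l)))" if "\<not> literal_true \<alpha> l" for l
      using that by (auto simp: falsifies_def literal_true_def \<alpha>_def selector_def)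
    have j: "fst l div b < b" if "l \<in> {l1, l2, l3}" for l
    proof -
      have "fst l < b * b" using three c that by (fastforce simp: three_cnf_def)
      then show ?thesis by (simp add: less_mult_imp_div_less)
    qed
    have lt: "p (selector b (literal_code l)) + p (selector b (literal_code l) + 1) < 2 ^ b"
      if "l \<in> {l1, l2, l3}" for l
      using N[OF j[OF that]] \<open>N < 2 ^ b\<close> by (simp add: selector_def)
    \<comment> \<open>The triple of the actual powers: none of its six thresholds is met, although
      it is a listed constraint.\<close>
    let ?g = "clause_constraint b (literal_code l1, literal_code l2, literal_code l3)
      (p (selector b (literal_code l1))) (p (selector b (literal_code l2))) (p (selector b (literal_code l3)))"
    have "?g \<in> set (clause_constraints b (literal_code l1, literal_code l2, literal_code l3))"
      unfolding set_clause_constraints using f nt lt[of l1] lt[of l2] lt[of l3] by fastforce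
    then have "holds p ?g" using w c by (force simp: filter_empty_conv)
    then show False using lt[of l1] lt[of l2] lt[of l3]
      by (auto simp: holds_def clause_constraint_def)
  qed
  then show ?thesis unfolding satisfiable_def by blast
qed

section \<open>Computing the tables\<close>

text \<open>A scalar is cell 0 of an array of its own. The given program for Power Vertex Cover is shifted
  to the arrays from 30 on, so that 30 is its input and 31 its output.\<close>

abbreviation (input) "aResult \<equiv> 1 :: nat"
abbreviation (input) "aBits \<equiv> 2 :: nat"
abbreviation (input) "aSquare \<equiv> 3 :: nat"
abbreviation (input) "aPtr \<equiv> 4 :: nat"
abbreviation (input) "aQ \<equiv> 5 :: nat"
abbreviation (input) "aVertex \<equiv> 6 :: nat"
abbreviation (input) "aEdges \<equiv> 7 :: nat"
abbreviation (input) "aBudget \<equiv> 8 :: nat"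
abbreviation (input) "aPow \<equiv> 9 :: nat"
abbreviation (input) "aTable \<equiv> 10 :: nat"
abbreviation (input) "aIdx \<equiv> 11 :: nat"
abbreviation (input) "aSel \<equiv> 12 :: nat"
abbreviation (input) "aRow \<equiv> 13 :: nat"
abbreviation (input) "aSign \<equiv> 14 :: nat"
abbreviation (input) "aLit \<equiv> 15 :: nat"
abbreviation (input) "aOff \<equiv> 16 :: nat"
abbreviation (input) "aI \<equiv> 17 :: nat"
abbreviation (input) "aJ \<equiv> 18 :: nat"
abbreviation (input) "aX \<equiv> 19 :: nat"
abbreviation (input) "aC \<equiv> 20 :: nat"
abbreviation (input) "aL1 \<equiv> 21 :: nat"
abbreviation (input) "aL2 \<equiv> 22 :: nat"
abbreviation (input) "aL3 \<equiv> 23 :: nat"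
abbreviation (input) "aA1 \<equiv> 24 :: nat"
abbreviation (input) "aA2 \<equiv> 25 :: nat"
abbreviation (input) "aA3 \<equiv> 26 :: nat"
abbreviation (input) "aSum \<equiv> 27 :: nat"
abbreviation (input) "aOut \<equiv> 30 :: nat"
abbreviation (input) "aPower \<equiv> 31 :: nat"

lemma runs_Seq_frame:
  assumes "runs c1 s t1 P"
    and "\<And>s1. P s1 \<Longrightarrow> (\<And>a. a \<notin> writes c1 \<Longrightarrow> s1 a = s a) \<Longrightarrow> runs c2 s1 t2 Q"
  shows "runs (Seq c1 c2) s (t1 + t2) Q"
  by (intro runs_Seq, rule runs_mono[OF runs_frame[OF assms(1)]]) (use assms(2) in auto)

lemma runs_Seq_Write:
  "runs c (s(a := (s a)(eval_expr e1 s := eval_expr e2 s))) t Q \<Longrightarrow>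
     runs (Seq (Write a e1 e2) c) s (1 + t) Q"
  by (intro runs_Seq runs_Write)

lemma runs_Seq_Write_eq:
  "eval_expr e1 s = i \<Longrightarrow> eval_expr e2 s = v \<Longrightarrow> runs c (s(a := (s a)(i := v))) t Q \<Longrightarrow>
     runs (Seq (Write a e1 e2) c) s (1 + t) Q"
  using runs_Seq_Write by blast

lemma runs_Write_eq:
  "eval_expr e1 s = i \<Longrightarrow> eval_expr e2 s = v \<Longrightarrow> Q (s(a := (s a)(i := v))) \<Longrightarrow>
     runs (Write a e1 e2) s 1 Q"
  using runs_Write by blast

lemma runs_For_post:
  assumes "\<And>s'. I N s' \<Longrightarrow> P s'" "I 0 s" "\<And>k s v. I k s \<Longrightarrow> I k (s(i := v))"
    and "\<And>s1. (\<And>a. a \<notin> insert i (writes c) \<Longrightarrow> s1 a = s a) \<Longrightarrow> eval_expr e s1 = N"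
    and "\<And>k s1. k < N \<Longrightarrow> I k s1 \<Longrightarrow> s1 i 0 = k \<Longrightarrow>
       (\<And>a. a \<notin> insert i (writes c) \<Longrightarrow> s1 a = s a) \<Longrightarrow> runs c s1 t (I (Suc k))"
    and "i \<notin> writes c"
  shows "runs (For i e c) s (N * (t + 2) + 2) P"
  by (rule runs_mono[OF runs_For[where I = I], OF assms(2-6) order_refl assms(1)])

lemma runs_WhileLess_post:
  assumes "\<And>k s'. I k s' \<Longrightarrow> k \<le> N \<Longrightarrow> \<not> eval_expr e1 s' < eval_expr e2 s' \<Longrightarrow> P s'"
    and "I k s" "k \<le> N"
    and "\<And>k s. I k s \<Longrightarrow> eval_expr e1 s < eval_expr e2 s \<Longrightarrow> k < N \<and> runs c s t (I (Suc k))"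
  shows "runs (WhileLess e1 e2 c) s ((N - k) * (t + 1) + 1) P"
  by (rule runs_mono[OF runs_WhileLess[where I = I], OF assms(2-4) order_refl]) (use assms(1) in auto)

text \<open>The square root of \<open>n\<close> rounded up, except that \<open>bits 0 = 1\<close>
  keeps groups nonempty.\<close>

definition bits :: "nat \<Rightarrow> nat" where
  "bits n = (LEAST b. 0 < b \<and> n \<le> b * b)"

lemma bits: "0 < bits n" "n \<le> bits n * bits n"
proof -
  have "0 < bits n \<and> n \<le> bits n * bits n"
    unfolding bits_def by (rule LeastI[of _ "n + 1"]) simp
  then show "0 < bits n" "n \<le> bits n * bits n" by auto
qed

lemma bits_le: "0 < b \<Longrightarrow> n \<le> b * b \<Longrightarrow> bits n \<le> b"
  unfolding bits_def by (rule Least_le) simp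

text \<open>Without multiplication the square is maintained through
  \<open>(b + 1) * (b + 1) = b * b + (b + b) + 1\<close>.\<close>

definition compute_bits :: prog where
  "compute_bits = Seq (Set aBits (Const 1)) (Seq (Set aSquare (Const 1))
     (WhileLess (Var aSquare) (Read 0 (Const 0))
       (Seq (Set aSquare (Add (Add (Var aSquare) (Add (Var aBits) (Var aBits))) (Const 1)))
         (Set aBits (Add (Var aBits) (Const 1))))))"

lemma runs_compute_bits:
  "runs compute_bits s (3 * bits (s 0 0)) (\<lambda>s'. s' aBits 0 = bits (s 0 0))"
proof -
  define n where "n = s 0 0"
  define I :: "nat \<Rightarrow> memory \<Rightarrow> bool" where "I k s \<longleftrightarrow> s aBits 0 = k + 1 \<and> s aSquare 0 = (k + 1) * (k + 1) \<and> k + 1 \<le> bits n \<and> s 0 0 = n" for k s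
  have "runs compute_bits s (1 + (1 + ((bits n - 1 - 0) * ((1 + 1) + 1) + 1))) (\<lambda>s'. s' aBits 0 = bits n)"
    unfolding compute_bits_def
  proof (intro runs_Seq_Write, rule runs_WhileLess_post[where I = I], goal_cases)
    case 2
    show ?case using bits[of n] by (simp add: I_def n_def)
  next
    case (4 k s)
    then have "(k + 1) * (k + 1) < n" by (simp add: I_def)
    then have "\<not> bits n \<le> k + 1"
      using bits(2)[of n] mult_le_mono[of "bits n" "k + 1" "bits n" "k + 1"] by linarith
    with 4 show ?case
      by (intro conjI runs_Seq_Write runs_Write) (auto simp: I_def algebra_simps)
  next
    case (1 k s')
    then have "I k s'" "n \<le> (k + 1) * (k + 1)" by (auto simp: I_def)
    with bits_le[of "k + 1" n] show ?case by (auto simp: I_def)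
  qed auto
  moreover have "1 + (1 + ((bits n - 1 - 0) * ((1 + 1) + 1) + 1)) = 3 * bits n"
    using bits(1)[of n] by simp
  ultimately show ?thesis by (simp only: n_def)
qed

definition compute_Q :: prog where
  "compute_Q = Seq (Set aQ (Const 1)) (For aI (Var aBits) (Set aQ (Add (Var aQ) (Var aQ))))"

lemma runs_compute_Q:
  "runs compute_Q s (1 + (s aBits 0 * (1 + 2) + 2)) (\<lambda>s'. s' aQ 0 = 2 ^ s aBits 0)"
  unfolding compute_Q_def
  by (intro runs_Seq_Write runs_For[where I = "\<lambda>k s. s aQ 0 = 2 ^ k"] runs_Write) auto

text \<open>Row \<open>x\<close> of length \<open>Q\<close>, starting at cell \<open>x * Q\<close>,
  holds bit \<open>x\<close> of every number below \<open>Q\<close>. Bits are tabulated because the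
  machine has no division.\<close>

definition bit_table :: "nat \<Rightarrow> nat \<Rightarrow> memory \<Rightarrow> bool" where
  "bit_table Q m s \<longleftrightarrow> (\<forall>k<m. s aTable k = of_bool (bit (k mod Q) (k div Q)))"

text \<open>Bit \<open>x\<close> of \<open>a\<close> is 0 below \<open>2 ^ x\<close>, 1 from there
  up to \<open>2 ^ (x + 1)\<close>, and then periodic with period \<open>2 ^ (x + 1)\<close>, so
  later entries are copied from earlier ones in the row.\<close>

definition compute_table :: prog where
  "compute_table = Seq (Set aPow (Const 1)) (Seq (Set aIdx (Const 0))
     (For aX (Var aBits) (Seq
       (For aA1 (Var aQ) (Seq
         (IfLess (Var aA1) (Var aPow) (Write aTable (Var aIdx) (Const 0))
           (IfLess (Var aA1) (Add (Var aPow) (Var aPow)) (Write aTable (Var aIdx) (Const 1))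
             (Write aTable (Var aIdx) (Read aTable (Sub (Var aIdx) (Add (Var aPow) (Var aPow)))))))
         (Set aIdx (Add (Var aIdx) (Const 1)))))
       (Set aPow (Add (Var aPow) (Var aPow))))))"

lemma bit_minus_twice_power:
  fixes a :: nat
  assumes "2 ^ x + 2 ^ x \<le> a"
  shows "bit (a - (2 ^ x + 2 ^ x)) x = bit a x"
proof -
  define d where "d = a - (2 ^ x + 2 ^ x)"
  have "a = d + 2 * 2 ^ x" using assms by (simp add: d_def)
  then have "a div 2 ^ x = d div 2 ^ x + 2" by simp
  then show ?thesis unfolding d_def[symmetric] bit_iff_odd by simp
qed

lemma bit_table_Suc:
  assumes "bit_table Q m s" "v = of_bool (bit (m mod Q) (m div Q))" "k = m"
  shows "bit_table Q (Suc m) (s(aTable := (s aTable)(k := v)))"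
  using assms by (auto simp: bit_table_def less_Suc_eq)

lemma runs_compute_table:
  assumes Q: "s aQ 0 = Q" and b: "s aBits 0 = b"
  shows "runs compute_table s (1 + (1 + (b * ((Q * ((1 + 1 + 1 + 1) + 2) + 2 + 1) + 2) + 2)))
    (\<lambda>s'. s' aIdx 0 = b * Q \<and> bit_table Q (b * Q) s')"
  unfolding compute_table_def
proof (intro runs_Seq_Write, rule runs_For_post[where
    I = "\<lambda>x s. s aPow 0 = 2 ^ x \<and> s aIdx 0 = x * Q \<and> bit_table Q (x * Q) s"], goal_cases)
  case (5 x s1)
  then have s1: "s1 aPow 0 = 2 ^ x" "s1 aQ 0 = Q" using Q by auto
  show ?case
  proof (rule runs_Seq_frame)
    show "runs (For aA1 (Var aQ) (Seq
         (IfLess (Var aA1) (Var aPow) (Write aTable (Var aIdx) (Const 0))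
           (IfLess (Var aA1) (Add (Var aPow) (Var aPow)) (Write aTable (Var aIdx) (Const 1))
             (Write aTable (Var aIdx) (Read aTable (Sub (Var aIdx) (Add (Var aPow) (Var aPow)))))))
         (Set aIdx (Add (Var aIdx) (Const 1))))) s1 (Q * ((1 + 1 + 1 + 1) + 2) + 2)
      (\<lambda>s'. s' aIdx 0 = x * Q + Q \<and> bit_table Q (x * Q + Q) s')"
    proof (rule runs_For[where I = "\<lambda>a s. s aIdx 0 = x * Q + a \<and> bit_table Q (x * Q + a) s"], goal_cases)
      case (4 a s2)
      then have s2: "s2 aPow 0 = 2 ^ x" "s2 aQ 0 = Q" "s2 aIdx 0 = x * Q + a" "s2 aA1 0 = a"
        and t: "bit_table Q (x * Q + a) s2" and a: "a < Q"
        using s1 by auto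
      have dm: "(x * Q + a) mod Q = a" "(x * Q + a) div Q = x" using a by auto
      define P where "P s' \<longleftrightarrow> s' aIdx 0 = x * Q + a \<and> bit_table Q (x * Q + Suc a) s'"
        for s' :: memory
      show ?case
      proof (rule runs_Seq_frame[where P = P],
          intro runs_IfLess, goal_cases)
        case 1
        then have "\<not> bit a x" by (simp add: s2 bit_iff_odd)
        with t a show ?case
          by (intro runs_mono[OF runs_Write[where Q = P]]) (auto simp: P_def s2 dm intro!: bit_table_Suc)
      next
        case 2
        then have "a div 2 ^ x = 1" by (simp add: s2 div_nat_eqI)
        then have "bit a x" by (simp add: bit_iff_odd)
        with t a show ?case
          by (intro runs_mono[OF runs_Write[where Q = P]]) (auto simp: P_def s2 dm intro!: bit_table_Suc)
      next
        case 3
        define d where "d = a - (2 ^ x + 2 ^ x)"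
        have d: "bit d x = bit a x" "d < Q"
          using 3 a bit_minus_twice_power[of x a] by (auto simp: s2 d_def)
        \<comment> \<open>The copied cell lies strictly before the current one and in the same row,
          hence it is already filled.\<close>
        have e: "x * Q + a - (2 ^ x + 2 ^ x) = x * Q + d" "x * Q + d < x * Q + a"
        proof -
          have "0 < (2::nat) ^ x" by simp
          moreover have "2 ^ x + 2 ^ x \<le> a" using 3 by (simp add: s2)
          ultimately have "d < a" unfolding d_def by linarith
          then show "x * Q + a - (2 ^ x + 2 ^ x) = x * Q + d" "x * Q + d < x * Q + a"
            using 3 by (auto simp: s2 d_def)
        qed
        have "s2 aTable (x * Q + d) = of_bool (bit a x)"
          using t e d by (simp add: bit_table_def)
        with t a show ?case by (intro runs_Write) (auto simp: P_def s2 dm e intro!: bit_table_Suc)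
      next
        case (4 s3)
        then show ?case using s2 by (intro runs_Write) (auto simp: P_def bit_table_def)
      qed
    qed (use 5 Q in \<open>auto simp: bit_table_def\<close>)
  next
    fix s2 assume "s2 aIdx 0 = x * Q + Q \<and> bit_table Q (x * Q + Q) s2"
    then show "runs (Set aPow (Add (Var aPow) (Var aPow))) s2 1
      (\<lambda>s. s aPow 0 = 2 ^ Suc x \<and> s aIdx 0 = Suc x * Q \<and> bit_table Q (Suc x * Q) s)"
      if "\<And>a. a \<notin> writes (For aA1 (Var aQ) (Seq
         (IfLess (Var aA1) (Var aPow) (Write aTable (Var aIdx) (Const 0))
           (IfLess (Var aA1) (Add (Var aPow) (Var aPow)) (Write aTable (Var aIdx) (Const 1))
             (Write aTable (Var aIdx) (Read aTable (Sub (Var aIdx) (Add (Var aPow) (Var aPow)))))))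
         (Set aIdx (Add (Var aIdx) (Const 1))))) \<Longrightarrow> s2 a = s1 a"
      using that s1 by (intro runs_Write) (auto simp: bit_table_def add.commute)
  qed
qed (use Q b in \<open>auto simp: bit_table_def\<close>)

text \<open>These arrays replace division by 2 and by \<open>b\<close> when a literal code is
  decoded. The row offset is stored premultiplied by \<open>Q\<close> for direct access to the bit
  table.\<close>

definition literal_tables :: "nat \<Rightarrow> nat \<Rightarrow> nat \<Rightarrow> memory \<Rightarrow> bool" where
  "literal_tables b Q m s \<longleftrightarrow> (\<forall>l<m. s aSel l = selector b l \<and>
     s aRow l = (l div 2 mod b) * Q \<and> s aSign l = l mod 2)"

text \<open>Codes are visited in increasing order, and \<open>2 * v\<close> and
  \<open>2 * v + 1\<close> differ only in the sign; hence the body treats two codes per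
  variable.\<close>

definition compute_literals :: prog where
  "compute_literals = Seq (Set aLit (Const 0)) (For aJ (Var aBits) (Seq (Set aOff (Const 0))
     (For aX (Var aBits)
       (Seq (Write aSel (Var aLit) (Add (Var aJ) (Var aJ)))
       (Seq (Write aRow (Var aLit) (Var aOff))
       (Seq (Write aSign (Var aLit) (Const 0))
       (Seq (Set aLit (Add (Var aLit) (Const 1)))
       (Seq (Write aSel (Var aLit) (Add (Var aJ) (Var aJ)))
       (Seq (Write aRow (Var aLit) (Var aOff))
       (Seq (Write aSign (Var aLit) (Const 1))
       (Seq (Set aLit (Add (Var aLit) (Const 1)))
         (Set aOff (Add (Var aOff) (Var aQ))))))))))))))"

lemma runs_compute_literals:
  assumes Q: "s aQ 0 = Q" and b: "s aBits 0 = b"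
  shows "runs compute_literals s (1 + (b * ((1 + (b * (9 + 2) + 2)) + 2) + 2))
    (literal_tables b Q (2 * b * b))"
  unfolding compute_literals_def
proof (intro runs_Seq_Write, rule runs_For_post[where
    I = "\<lambda>j s. s aLit 0 = 2 * (j * b) \<and> literal_tables b Q (2 * (j * b)) s"], goal_cases)
  case (5 j s1)
  show ?case
  proof (rule runs_Seq_Write, rule runs_For_post[where I = "\<lambda>x s. s aLit 0 = 2 * (j * b + x) \<and>
      s aOff 0 = x * Q \<and> literal_tables b Q (2 * (j * b + x)) s"], goal_cases)
    case (5 x s2)
    have dm: "(j * b + x) mod b = x" "(j * b + x) div b = j"
      using \<open>x < b\<close> by auto
    define m where "m = 2 * (j * b + x)"
    have s2: "s2 aJ 0 = j" "s2 aLit 0 = m" "s2 aOff 0 = x * Q" "s2 aQ 0 = Q"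
      and t: "literal_tables b Q m s2"
      using 5 \<open>s1 aJ 0 = j\<close> \<open>\<And>a. a \<notin> _ \<Longrightarrow> s1 a = _ a\<close> Q by (auto simp: m_def)
    have m: "selector b m = j + j" "selector b (Suc m) = j + j"
      "m div 2 mod b = x" "Suc m div 2 mod b = x" "m mod 2 = 0" "Suc m mod 2 = 1"
      using \<open>x < b\<close> by (simp_all add: selector_def m_def dm) presburger?
    have Suc_m: "2 * (j * b + Suc x) = Suc (Suc m)" by (simp add: m_def)
    \<comment> \<open>Nested like the time bounds that \<open>runs_Seq_Write_eq\<close> produces, so
      that the rule applies repeatedly.\<close>
    have nine: "9 = (1+(1+(1+(1+(1+(1+(1+(1+1))))))) :: nat)" by simp
    show ?case
      unfolding Suc_m nine using t
      apply -
      apply (rule runs_Seq_Write_eq, (simp add: s2; fail), (simp add: s2; fail))+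
      apply (rule runs_Write_eq, (simp add: s2; fail), (simp add: s2; fail))
      apply (auto simp: s2 literal_tables_def less_Suc_eq m)
      done
  qed (use 5 b in \<open>auto simp: literal_tables_def algebra_simps\<close>)
qed (use Q b in \<open>auto simp: literal_tables_def mult.assoc\<close>)

section \<open>Writing the instance\<close>

fun emit :: "expr list \<Rightarrow> prog" where
  "emit [] = Skip"
| "emit (e # es) = Seq (Write aOut (Var aPtr) e) (Seq (Set aPtr (Add (Var aPtr) (Const 1))) (emit es))"

lemma writes_emit: "writes (emit es) \<subseteq> {aOut, aPtr}"
  by (induction es) auto

text \<open>All values refer to the initial memory although \<open>aOut\<close> and
  \<open>aPtr\<close> change between the writes; this is what the first premise secures.\<close>

lemma runs_emit:
  assumes "\<And>e. e \<in> set es \<Longrightarrow> aOut \<notin> reads e \<and> aPtr \<notin> reads e"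
    and "s aOut = list_mem ys" "s aPtr 0 = length ys"
  shows "runs (emit es) s (2 * length es + 1) (\<lambda>s'.
     s' aOut = list_mem (ys @ map (\<lambda>e. eval_expr e s) es) \<and> s' aPtr 0 = length ys + length es)"
  using assms
proof (induction es arbitrary: s ys)
  case Nil
  then show ?case by (auto intro!: runs_Skip[simplified])
next
  case (Cons e es)
  let ?v = "eval_expr e s"
  let ?s = "s(aOut := list_mem (ys @ [?v]), aPtr := (s aPtr)(0 := length ys + 1))"
  have eq: "eval_expr e' ?s = eval_expr e' s" if "e' \<in> set es" for e'
    using Cons.prems(1)[of e'] that by (intro eval_expr_cong) auto
  have "runs (emit es) ?s (2 * length es + 1) (\<lambda>s'.
     s' aOut = list_mem ((ys @ [?v]) @ map (\<lambda>e. eval_expr e ?s) es) \<and>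
     s' aPtr 0 = length (ys @ [?v]) + length es)"
    using Cons.prems by (intro Cons.IH) auto
  moreover have "map (\<lambda>e. eval_expr e ?s) es = map (\<lambda>e. eval_expr e s) es"
    using eq by (intro map_cong) auto
  ultimately have r: "runs (emit es) ?s (2 * length es + 1) (\<lambda>s'.
     s' aOut = list_mem ((ys @ [?v]) @ map (\<lambda>e. eval_expr e s) es) \<and>
     s' aPtr 0 = length (ys @ [?v]) + length es)"
    by (simp only:)
  have "runs (emit (e # es)) s (1 + (1 + (2 * length es + 1))) (\<lambda>s'.
     s' aOut = list_mem (ys @ map (\<lambda>e. eval_expr e s) (e # es)) \<and>
     s' aPtr 0 = length ys + length (e # es))"
    unfolding emit.simps
    apply (rule runs_Seq_Write_eq[where i = "length ys" and v = ?v])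
      apply (simp add: Cons.prems)
     apply simp
    apply (rule runs_Seq_Write_eq[where i = 0 and v = "length ys + 1"])
      apply simp
     apply (simp add: Cons.prems)
    using r by (simp add: Cons.prems(2) list_mem_snoc fun_upd_other del: fun_upd_apply)
  then show ?case by simp
qed

lemma upt_simps:
  "[0..<1] = [0::nat]" "[0..<Suc 0] = [0::nat]" "[0..<2] = [0, 1::nat]" "[0..<3] = [0, 1, 2::nat]"
  "[0..<4] = [0, 1, 2, 3::nat]" "[0..<5] = [0, 1, 2, 3, 4::nat]" "[0..<6] = [0, 1, 2, 3, 4, 5::nat]"
  by (simp_all add: upt_rec)

definition gadget_exprs :: "(expr \<times> expr) list \<Rightarrow> expr list" where
  "gadget_exprs g = concat (map (\<lambda>r. Add (Var aVertex) (Const r) # fst (g ! r) # snd (g ! r) #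
     concat (map (\<lambda>r'. [Add (Var aVertex) (Const r), Add (Var aVertex) (Const r'), Var aQ]) [0..<r])) [0..<6])"

text \<open>The totals are accumulated on the way instead of multiplied afterwards;
  \<open>5 * Q\<close> is the least cost of a gadget.\<close>

definition emit_gadget :: "(expr \<times> expr) list \<Rightarrow> prog" where
  "emit_gadget g = Seq (emit (gadget_exprs g))
     (Seq (Set aVertex (Add (Var aVertex) (Const 6)))
     (Seq (Set aEdges (Add (Var aEdges) (Const 21)))
       (Set aBudget (Add (Var aBudget) (Add (Var aQ) (Add (Var aQ) (Add (Var aQ) (Add (Var aQ) (Var aQ)))))))))"

definition graph_code :: "nat \<Rightarrow> nat \<Rightarrow> (nat \<times> nat) list list \<Rightarrow> nat list" where
  "graph_code S Q gs = concat (map (\<lambda>(x, y, t). [x, y, t]) (graph_edges S Q gs))"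

text \<open>The two leading zeros reserve the header cells for the numbers of vertices and edges,
  known only when all constraints are written.\<close>

definition emitted :: "nat \<Rightarrow> nat \<Rightarrow> (nat \<times> nat) list list \<Rightarrow> memory \<Rightarrow> bool" where
  "emitted S Q gs s \<longleftrightarrow> s aOut = list_mem ([0, 0] @ graph_code S Q gs) \<and>
     s aPtr 0 = length ([0, 0] @ graph_code S Q gs) \<and>
     s aVertex 0 = S + 6 * length gs \<and> s aEdges 0 = 21 * length gs \<and>
     s aBudget 0 = 5 * Q * length gs"

definition emission_arrays :: "nat set" where
  "emission_arrays = {aOut, aPtr, aVertex, aEdges, aBudget}"

lemma emitted_upd: "a \<notin> emission_arrays \<Longrightarrow> emitted S Q gs s \<Longrightarrow> emitted S Q gs (s(a := v))"
  by (auto simp: emitted_def emission_arrays_def)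

lemma writes_emit_gadget: "writes (emit_gadget g) \<subseteq> emission_arrays"
  using writes_emit by (auto simp: emit_gadget_def emission_arrays_def)

lemma length_gadget_exprs: "length (gadget_exprs g) = 63"
  by (simp add: gadget_exprs_def upt_simps)

lemma set_gadget_exprs:
  assumes "length g = 6" "e \<in> set (gadget_exprs g)"
  shows "e \<in> fst ` set g \<or> e \<in> snd ` set g \<or> reads e \<subseteq> {aVertex, aQ}"
  using assms by (auto simp: gadget_exprs_def split: if_splits)

text \<open>63 numbers (three per edge) at two steps each, one step for the final
  \<open>Skip\<close> and three updates of totals make 130.\<close>

lemma runs_emit_gadget:
  assumes g: "length g = 6" and reads: "\<And>e1 e2. (e1, e2) \<in> set g \<Longrightarrow>
      {aOut, aPtr} \<inter> reads e1 = {} \<and> {aOut, aPtr} \<inter> reads e2 = {}"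
    and "emitted S Q gs s" "s aQ 0 = Q"
    and h: "map (\<lambda>(e1, e2). (eval_expr e1 s, eval_expr e2 s)) g = h"
  shows "runs (emit_gadget g) s 130 (emitted S Q (gs @ [h]))"
proof -
  let ?ys = "[0, 0] @ graph_code S Q gs"
  have s: "s aOut = list_mem ?ys" "s aPtr 0 = length ?ys" "s aVertex 0 = S + 6 * length gs"
     "s aEdges 0 = 21 * length gs" "s aBudget 0 = 5 * Q * length gs"
    using assms(3) by (simp_all only: emitted_def)
  have nth: "h ! r = (eval_expr (fst (g ! r)) s, eval_expr (snd (g ! r)) s)" if "r < 6" for r
    using that g unfolding h[symmetric] by (simp add: case_prod_unfold)
  have ev: "map (\<lambda>e. eval_expr e s) (gadget_exprs g) =
    concat (map (\<lambda>(x, y, t). [x, y, t]) (gadget_edges Q (S + 6 * length gs) h))"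
    by (simp add: gadget_exprs_def gadget_edges_def upt_simps nth s assms(4))
  have "runs (emit (gadget_exprs g)) s (2 * length (gadget_exprs g) + 1) (\<lambda>s'.
     s' aOut = list_mem (?ys @ map (\<lambda>e. eval_expr e s) (gadget_exprs g)) \<and>
     s' aPtr 0 = length ?ys + length (gadget_exprs g))"
  proof (rule runs_emit)
    fix e assume "e \<in> set (gadget_exprs g)"
    from set_gadget_exprs[OF g this] reads show "aOut \<notin> reads e \<and> aPtr \<notin> reads e" by fastforce
  qed (use s in auto)
  then have "runs (emit (gadget_exprs g)) s 127 (\<lambda>s'.
     s' aOut = list_mem ([0, 0] @ graph_code S Q (gs @ [h])) \<and>
     s' aPtr 0 = length ([0, 0] @ graph_code S Q (gs @ [h])))"
  proof (rule runs_mono)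
    show "2 * length (gadget_exprs g) + 1 \<le> 127" by (simp add: length_gadget_exprs)
    have "length (gadget_exprs g) =
      length (concat (map (\<lambda>(x, y, t). [x, y, t]) (gadget_edges Q (S + 6 * length gs) h)))"
      using arg_cong[OF ev, of length] by simp
    then show "s' aOut = list_mem ([0, 0] @ graph_code S Q (gs @ [h])) \<and>
        s' aPtr 0 = length ([0, 0] @ graph_code S Q (gs @ [h]))"
      if "s' aOut = list_mem (?ys @ map (\<lambda>e. eval_expr e s) (gadget_exprs g)) \<and>
        s' aPtr 0 = length ?ys + length (gadget_exprs g)" for s'
      using that unfolding ev by (simp add: graph_code_def graph_edges_snoc)
  qed
  then have "runs (emit_gadget g) s (127 + (1 + (1 + 1))) (emitted S Q (gs @ [h]))"
    unfolding emit_gadget_def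
  proof (rule runs_Seq_frame)
    fix s1
    assume 1: "s1 aOut = list_mem ([0, 0] @ graph_code S Q (gs @ [h])) \<and>
        s1 aPtr 0 = length ([0, 0] @ graph_code S Q (gs @ [h]))"
      and 2: "\<And>a. a \<notin> writes (emit (gadget_exprs g)) \<Longrightarrow> s1 a = s a"
    have "s1 aVertex = s aVertex" "s1 aEdges = s aEdges" "s1 aBudget = s aBudget" "s1 aQ = s aQ"
      using writes_emit[of "gadget_exprs g"] by (intro 2; fastforce)+
    with 1 show "runs (Seq (Set aVertex (Add (Var aVertex) (Const 6)))
     (Seq (Set aEdges (Add (Var aEdges) (Const 21)))
       (Set aBudget (Add (Var aBudget) (Add (Var aQ) (Add (Var aQ) (Add (Var aQ) (Add (Var aQ) (Var aQ)))))))))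
      s1 (1 + (1 + 1)) (emitted S Q (gs @ [h]))"
      by (intro runs_Seq_Write runs_Write) (simp add: emitted_def s assms(4))
  qed
  then show ?thesis by simp
qed

text \<open>Since \<open>step\<close> holds for every list \<open>gs1\<close> already written, the
  conclusion again has the form of \<open>step\<close>, so the rule nests along nested
  loops.\<close>

lemma runs_For_emitted:
  assumes "emitted S Q gs s" "i \<notin> emission_arrays"
    and bound: "\<And>s1. (\<And>a. a \<notin> insert i (writes c) \<Longrightarrow> s1 a = s a) \<Longrightarrow> eval_expr e s1 = N"
    and step: "\<And>k s1 gs1. k < N \<Longrightarrow> emitted S Q gs1 s1 \<Longrightarrow> s1 i 0 = k \<Longrightarrow>
       (\<And>a. a \<notin> insert i (writes c) \<Longrightarrow> s1 a = s a) \<Longrightarrow> runs c s1 t (emitted S Q (gs1 @ h k))"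
    and "i \<notin> writes c"
  shows "runs (For i e c) s (N * (t + 2) + 2) (emitted S Q (gs @ concat (map h [0..<N])))"
proof (rule runs_For[where I = "\<lambda>k. emitted S Q (gs @ concat (map h [0..<k]))"])
  fix k s1
  assume "k < N" "emitted S Q (gs @ concat (map h [0..<k])) s1" "s1 i 0 = k"
    "\<And>a. a \<notin> insert i (writes c) \<Longrightarrow> s1 a = s a"
  from step[OF this] show "runs c s1 t (emitted S Q (gs @ concat (map h [0..<Suc k])))" by simp
qed (use assms emitted_upd in auto)

definition emit_pairs :: prog where
  "emit_pairs = For aJ (Var aBits) (For aX (Sub (Var aQ) (Const 1)) (emit_gadget
     [(Add (Var aJ) (Var aJ), Add (Var aX) (Const 1)),
      (Add (Var aJ) (Var aJ), Add (Var aX) (Const 1)),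
      (Add (Var aJ) (Var aJ), Add (Var aX) (Const 1)),
      (Add (Add (Var aJ) (Var aJ)) (Const 1), Sub (Sub (Var aQ) (Const 1)) (Var aX)),
      (Add (Add (Var aJ) (Var aJ)) (Const 1), Sub (Sub (Var aQ) (Const 1)) (Var aX)),
      (Add (Add (Var aJ) (Var aJ)) (Const 1), Sub (Sub (Var aQ) (Const 1)) (Var aX))]))"

lemma not_writes_emit_gadget: "a \<notin> emission_arrays \<Longrightarrow> a \<notin> writes (emit_gadget g)"
  using writes_emit_gadget by blast

lemma runs_emit_pairs:
  assumes "emitted (2 * b) (2 ^ b) gs s" and Q: "s aQ 0 = 2 ^ b" and b: "s aBits 0 = b"
  shows "runs emit_pairs s (b * (((2 ^ b - 1) * (130 + 2) + 2) + 2) + 2)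
    (emitted (2 * b) (2 ^ b) (gs @ concat (map (pair_constraints b) [0..<b])))"
  unfolding emit_pairs_def
proof (rule runs_For_emitted[OF assms(1)], goal_cases)
  case (3 j s1 gs1)
  have s1: "s1 aQ 0 = 2 ^ b" using 3(4)[of aQ] Q not_writes_emit_gadget by (simp add: emission_arrays_def)
  show ?case unfolding pair_constraints_def
  proof (rule runs_For_emitted[OF 3(2)], goal_cases)
    case (3 x s2 gs2)
    have "s2 aQ = s1 aQ" "s2 aJ = s1 aJ"
      using not_writes_emit_gadget by (intro 3(4); simp add: emission_arrays_def)+
    with \<open>s1 aJ 0 = j\<close> s1 have s2: "s2 aQ 0 = 2 ^ b" "s2 aJ 0 = j" "s2 aX 0 = x" using 3 by auto
    show ?case by (rule runs_emit_gadget[OF _ _ 3(2)]) (auto simp: s2 pair_constraint_def)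
  next
    case (2 s2)
    have "s2 aQ = s1 aQ" using not_writes_emit_gadget by (intro 2) (simp add: emission_arrays_def)
    then show ?case using s1 by simp
  qed (simp_all add: not_writes_emit_gadget emission_arrays_def)
next
  case (2 s1)
  have "s1 aBits = s aBits" using not_writes_emit_gadget by (intro 2) (simp add: emission_arrays_def)
  then show ?case using b by simp
qed (simp_all add: not_writes_emit_gadget emission_arrays_def)

text \<open>The two truncated subtractions add up to the distance of two bits, that is, their
  exclusive or.\<close>

definition false_bit :: "nat \<Rightarrow> nat \<Rightarrow> expr" where
  "false_bit l a = (let x = Read aTable (Add (Read aRow (Var l)) (Var a)); y = Read aSign (Var l)
     in Add (Sub x y) (Sub y x))"

lemma eval_false_bit:
  assumes "literal_tables b Q m s" "bit_table Q (b * Q) s" "s l 0 < m" "s a 0 < Q" "0 < b"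
  shows "eval_expr (false_bit l a) s = of_bool (falsifies b (s l 0) (s a 0))"
proof -
  have "s l 0 div 2 mod b + 1 \<le> b" using assms(5) by (simp add: Suc_le_eq)
  then have "(s l 0 div 2 mod b + 1) * Q \<le> b * Q" by (rule mult_right_mono) simp
  then have "s l 0 div 2 mod b * Q + s a 0 < b * Q" using assms(4) by simp
  with assms show ?thesis
    by (auto simp: false_bit_def literal_tables_def bit_table_def falsifies_def Let_def odd_iff_mod_2_eq_one)
qed

definition literal_gadget :: "nat \<Rightarrow> nat \<Rightarrow> (expr \<times> expr) list" where
  "literal_gadget l a = [(Read aSel (Var l), Add (Var a) (Const 1)),
     (Add (Read aSel (Var l)) (Const 1), Sub (Var aQ) (Var a))]"

text \<open>A sum of three bits exceeds 2 exactly if all are 1, so one test expresses the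
  conjunction.\<close>

definition emit_clause :: prog where
  "emit_clause = For aA1 (Var aQ) (For aA2 (Var aQ) (For aA3 (Var aQ)
     (IfLess (Const 2) (Add (false_bit aL1 aA1) (Add (false_bit aL2 aA2) (false_bit aL3 aA3)))
       (emit_gadget (literal_gadget aL1 aA1 @ literal_gadget aL2 aA2 @ literal_gadget aL3 aA3))
       Skip)))"

lemma runs_emit_clause:
  assumes "emitted (2 * b) (2 ^ b) gs s" and Q: "s aQ 0 = 2 ^ b" and b: "0 < b"
    and t: "literal_tables b (2 ^ b) m s" "bit_table (2 ^ b) (b * 2 ^ b) s"
    and l: "s aL1 0 = l1" "s aL2 0 = l2" "s aL3 0 = l3" "l1 < m" "l2 < m" "l3 < m"
  shows "runs emit_clause s (2 ^ b * ((2 ^ b * ((2 ^ b * ((130 + 1) + 2) + 2) + 2) + 2) + 2) + 2)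
    (emitted (2 * b) (2 ^ b) (gs @ clause_constraints b (l1, l2, l3)))"
proof -
  let ?g = "literal_gadget aL1 aA1 @ literal_gadget aL2 aA2 @ literal_gadget aL3 aA3"
  note W = not_writes_emit_gadget[of _ ?g] 
  have fr: "s' aQ 0 = 2 ^ b" "literal_tables b (2 ^ b) m s'" "bit_table (2 ^ b) (b * 2 ^ b) s'"
    "s' aL1 0 = l1" "s' aL2 0 = l2" "s' aL3 0 = l3"
    if "\<forall>a. a \<notin> {aA1, aA2, aA3} \<union> emission_arrays \<longrightarrow> s' a = s a" for s'
    using that Q t l by (auto simp: literal_tables_def bit_table_def emission_arrays_def)
  have sub: "writes (emit_gadget ?g) \<subseteq> emission_arrays" by (rule writes_emit_gadget)
  show ?thesis
    unfolding emit_clause_def clause_constraints_def case_prod_conv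
  proof (rule runs_For_emitted[OF assms(1)], goal_cases)
    case (3 a1 s1 gs1)
    have f1: "s1 a = s a" if "a \<notin> {aA1, aA2, aA3} \<union> emission_arrays" for a
      using that sub by (intro 3(4)) auto
    show ?case
    proof (rule runs_For_emitted[OF 3(2)], goal_cases)
      case (3 a2 s2 gs2)
      have f2: "s2 a = s1 a" if "a \<notin> {aA2, aA3} \<union> emission_arrays" for a
        using that sub by (intro 3(4)) auto
      show ?case
      proof (rule runs_For_emitted[OF 3(2)], goal_cases)
        case (3 a3 s3 gs3)
        have f3: "s3 a = s2 a" if "a \<notin> {aA3} \<union> emission_arrays" for a
          using that sub by (intro 3(4)) auto
        have "\<forall>a. a \<notin> {aA1, aA2, aA3} \<union> emission_arrays \<longrightarrow> s3 a = s a"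
          using f1 f2 f3 by auto
        note s3 = fr[OF this]
        have "s3 aA1 0 = a1" "s3 aA2 0 = a2" "s3 aA3 0 = a3"
          using f3 f2 \<open>s1 aA1 0 = a1\<close> \<open>s2 aA2 0 = a2\<close> \<open>s3 aA3 0 = a3\<close>
          by (auto simp: emission_arrays_def)
        note s3 = s3 this
        have ev: "eval_expr (Add (false_bit aL1 aA1) (Add (false_bit aL2 aA2) (false_bit aL3 aA3))) s3 =
          of_bool (falsifies b l1 a1) + (of_bool (falsifies b l2 a2) + of_bool (falsifies b l3 a3))"
          using eval_false_bit[OF s3(2,3) _ _ b] s3 l \<open>a1 < _\<close> \<open>a2 < _\<close> \<open>a3 < _\<close> by simp
        show ?case
        proof (rule runs_IfLess, goal_cases)
          case 1
          then have "falsifies b l1 a1 \<and> falsifies b l2 a2 \<and> falsifies b l3 a3"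
            unfolding ev by (auto simp: of_bool_def split: if_splits)
          moreover have "runs (emit_gadget ?g) s3 130
            (emitted (2 * b) (2 ^ b) (gs3 @ [clause_constraint b (l1, l2, l3) a1 a2 a3]))"
            using s3(2) l by (intro runs_emit_gadget[OF _ _ 3(2)])
              (auto simp: s3 literal_gadget_def clause_constraint_def literal_tables_def)
          ultimately show ?case by simp
        next
          case 2
          then have "\<not> (falsifies b l1 a1 \<and> falsifies b l2 a2 \<and> falsifies b l3 a3)"
            unfolding ev by auto
          then have "runs Skip s3 1 (emitted (2 * b) (2 ^ b) (gs3 @
            (if falsifies b l1 a1 \<and> falsifies b l2 a2 \<and> falsifies b l3 a3
              then [clause_constraint b (l1, l2, l3) a1 a2 a3] else [])))"
            using 3(2) by (intro runs_Skip) auto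
          then show ?case by (rule runs_mono) simp_all
        qed
      next
        case (2 s3)
        have "s3 aQ = s2 aQ" using W by (intro 2) (simp add: emission_arrays_def)
        moreover have "s2 aQ = s1 aQ" "s1 aQ = s aQ" using f1 f2 by (auto simp: emission_arrays_def)
        ultimately show ?case using Q by simp
      qed (use W in \<open>simp_all add: emission_arrays_def\<close>)
    next
      case (2 s2)
      have "s2 aQ = s1 aQ" using W by (intro 2) (simp add: emission_arrays_def)
      moreover have "s1 aQ = s aQ" using f1 by (auto simp: emission_arrays_def)
      ultimately show ?case using Q by simp
    qed (use W in \<open>simp_all add: emission_arrays_def\<close>)
  next
    case (2 s1)
    have "s1 aQ = s aQ" using W by (intro 2) (simp add: emission_arrays_def)
    then show ?case using Q by simp
  qed (use W in \<open>simp_all add: emission_arrays_def\<close>)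
qed

definition emit_clauses :: prog where
  "emit_clauses = (let p = Add (Var aC) (Add (Var aC) (Var aC)) in
     For aC (Read 0 (Const 1))
       (Seq (Set aL1 (Read 0 (Add p (Const 2)))) (Seq (Set aL2 (Read 0 (Add p (Const 3))))
       (Seq (Set aL3 (Read 0 (Add p (Const 4)))) emit_clause))))"

lemma writes_emit_clause: "writes emit_clause \<subseteq> {aA1, aA2, aA3} \<union> emission_arrays"
  using writes_emit_gadget unfolding emit_clause_def by auto

lemma runs_emit_clauses:
  assumes "emitted (2 * b) (2 ^ b) gs s" and Q: "s aQ 0 = 2 ^ b" and b: "0 < b"
    and t: "literal_tables b (2 ^ b) k s" "bit_table (2 ^ b) (b * 2 ^ b) s"
    and m: "s 0 1 = length cs"
    and cs: "\<And>c. c < length cs \<Longrightarrow> (s 0 (3 * c + 2), s 0 (3 * c + 3), s 0 (3 * c + 4)) = cs ! c"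
    and k: "\<And>l1 l2 l3. (l1, l2, l3) \<in> set cs \<Longrightarrow> l1 < k \<and> l2 < k \<and> l3 < k"
  shows "runs emit_clauses s (length cs * ((1 + (1 + (1 +
      (2 ^ b * ((2 ^ b * ((2 ^ b * ((130 + 1) + 2) + 2) + 2) + 2) + 2) + 2)))) + 2) + 2)
    (emitted (2 * b) (2 ^ b) (gs @ concat (map (clause_constraints b) cs)))"
proof -
  have n: "a \<notin> writes emit_clause" if "a \<notin> {aA1, aA2, aA3} \<union> emission_arrays" for a
    using that writes_emit_clause by blast
  have "runs emit_clauses s (length cs * ((1 + (1 + (1 +
      (2 ^ b * ((2 ^ b * ((2 ^ b * ((130 + 1) + 2) + 2) + 2) + 2) + 2) + 2)))) + 2) + 2)
    (emitted (2 * b) (2 ^ b) (gs @ concat (map (\<lambda>c. clause_constraints b (cs ! c)) [0..<length cs])))"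
    unfolding emit_clauses_def Let_def
  proof (rule runs_For_emitted[OF assms(1)], goal_cases)
    case (3 c s1 gs1)
    have f: "s1 a = s a" if "a \<notin> {aC, aL1, aL2, aL3, aA1, aA2, aA3} \<union> emission_arrays" for a
      using that by (intro 3(4)) (auto simp: n)
    have s1: "s1 0 = s 0" "s1 aQ = s aQ" "s1 aTable = s aTable" "s1 aSel = s aSel" "s1 aRow = s aRow"
      "s1 aSign = s aSign"
      by (intro f; simp add: emission_arrays_def)+
    obtain l1 l2 l3 where c: "cs ! c = (l1, l2, l3)" by (cases "cs ! c")
    have "c + (c + c) = 3 * c" by simp
    with c cs[OF 3(1)] have l: "s 0 (c + (c + c) + 2) = l1" "s 0 (c + (c + c) + 3) = l2"
      "s 0 (c + (c + c) + 4) = l3"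
      by (simp_all only: prod.inject)
    have "(l1, l2, l3) \<in> set cs" using c 3(1) by (metis nth_mem)
    note lk = k[OF this]
    show ?case
      apply (rule runs_Seq_Write_eq[where i = 0 and v = l1], (simp; fail), (insert l, simp add: s1 3(3); fail))
      apply (rule runs_Seq_Write_eq[where i = 0 and v = l2], (simp; fail), (insert l, simp add: s1 3(3); fail))
      apply (rule runs_Seq_Write_eq[where i = 0 and v = l3], (simp; fail), (insert l, simp add: s1 3(3); fail))
      unfolding c
      apply (rule runs_emit_clause[where m = k])
      using 3(2) t Q b lk
      by (auto simp: emitted_def literal_tables_def bit_table_def s1)
  next
    case (2 s1)
    have "s1 0 = s 0" by (intro 2) (simp add: n emission_arrays_def)
    then show ?case using m by simp
  qed (simp_all add: n emission_arrays_def)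
  moreover have "map (\<lambda>c. clause_constraints b (cs ! c)) [0..<length cs] = map (clause_constraints b) cs"
    by (rule nth_equalityI) auto
  ultimately show ?thesis by simp
qed

section \<open>The complete reduction and the final comparison\<close>

definition reduce :: prog where
  "reduce = Seq compute_bits (Seq compute_Q (Seq compute_table (Seq compute_literals
     (Seq (emit [Const 0, Const 0]) (Seq (Set aVertex (Add (Var aBits) (Var aBits)))
     (Seq emit_pairs (Seq emit_clauses
     (Seq (Write aOut (Const 0) (Var aVertex)) (Write aOut (Const 1) (Var aEdges))))))))))"

lemma writes_reduce_parts:
  "writes compute_bits = {aBits, aSquare}"
  "writes compute_Q = {aQ, aI}"
  "writes compute_table = {aPow, aIdx, aX, aA1, aTable}"
  "writes compute_literals = {aLit, aJ, aOff, aX, aSel, aRow, aSign}"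
  "writes (emit [Const 0, Const 0]) = {aOut, aPtr}"
  "writes emit_pairs \<subseteq> {aJ, aX} \<union> emission_arrays"
  "writes emit_clauses \<subseteq> {aC, aL1, aL2, aL3, aA1, aA2, aA3} \<union> emission_arrays"
  using writes_emit_gadget writes_emit_clause
  by (auto simp: compute_bits_def compute_Q_def compute_table_def compute_literals_def
      emit_pairs_def emit_clauses_def Let_def)

text \<open>Its use: \<open>aSum\<close> and every array above \<open>aOut\<close> are still 0
  afterwards, so the shifted program finds a clean memory and \<open>decide\<close> a zero
  accumulator.\<close>

lemma writes_reduce: "writes reduce \<subseteq> {aBits..aA3} \<union> {aOut}"
  using writes_reduce_parts(6,7) unfolding reduce_def writes.simps writes_reduce_parts(1-5)
  by (auto simp: emission_arrays_def)

text \<open>The sum is left in the shape in which the rules for sequences and loops build it, so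
  that it matches without arithmetic; \<open>reduce_time_le\<close> then estimates it.\<close>

definition reduce_time :: "nat \<Rightarrow> nat \<Rightarrow> nat" where
  "reduce_time b m = (let Q = 2 ^ b in
     3 * b + (1 + (b * (1 + 2) + 2) + (1 + (1 + (b * ((Q * ((1 + 1 + 1 + 1) + 2) + 2 + 1) + 2) + 2))
     + (1 + (b * ((1 + (b * (9 + 2) + 2)) + 2) + 2) + (2 * length [Const 0, Const 0] + 1 + (1 +
     (b * (((Q - 1) * (130 + 2) + 2) + 2) + 2 + (m * ((1 + (1 + (1 +
      (Q * ((Q * ((Q * ((130 + 1) + 2) + 2) + 2) + 2) + 2) + 2)))) + 2) + 2 + (1 + 1)))))))))"

lemma length_graph_edges: "length (graph_edges S M gs) = 21 * length gs"
  by (induction gs rule: rev_induct)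
    (simp_all add: graph_edges_snoc, simp_all add: graph_edges_def gadget_edges_def upt_simps)

lemma runs_reduce:
  assumes s0: "\<And>a. 0 < a \<Longrightarrow> s a = (\<lambda>_. 0)" and n: "s 0 0 = n" and m: "s 0 1 = length cs"
    and cs: "\<And>c. c < length cs \<Longrightarrow> (s 0 (3 * c + 2), s 0 (3 * c + 3), s 0 (3 * c + 4)) = cs ! c"
    and k: "\<And>l1 l2 l3. (l1, l2, l3) \<in> set cs \<Longrightarrow> l1 < 2 * n \<and> l2 < 2 * n \<and> l3 < 2 * n"
    and b: "b = bits n" and gs: "gs = constraints b cs"
  shows "runs reduce s (reduce_time b (length cs)) (\<lambda>s'.
     s' aOut = list_mem ([2 * b + 6 * length gs, length (graph_edges (2 * b) (2 ^ b) gs)]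
       @ graph_code (2 * b) (2 ^ b) gs) \<and>
     s' aVertex 0 = 2 * b + 6 * length gs \<and> s' aBudget 0 = 5 * 2 ^ b * length gs \<and>
     s' aIdx 0 = b * 2 ^ b \<and> s' aBits 0 = b)"
  unfolding reduce_def reduce_time_def Let_def
proof (rule runs_Seq_frame[OF runs_compute_bits[of s, unfolded n, folded b]])
  have b0: "0 < b" and nb: "n \<le> b * b" using bits b by auto
  have k': "l1 < 2 * b * b \<and> l2 < 2 * b * b \<and> l3 < 2 * b * b" if "(l1, l2, l3) \<in> set cs" for l1 l2 l3
    using k[OF that] nb by auto
  fix s1 :: memory
  assume p1: "s1 aBits 0 = b" and f1: "\<And>a. a \<notin> writes compute_bits \<Longrightarrow> s1 a = s a"
  note r2 = runs_compute_Q[of s1, unfolded p1]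
  show "runs (Seq compute_Q (Seq compute_table (Seq compute_literals
     (Seq (emit [Const 0, Const 0]) (Seq (Set aVertex (Add (Var aBits) (Var aBits)))
     (Seq emit_pairs (Seq emit_clauses
     (Seq (Write aOut (Const 0) (Var aVertex)) (Write aOut (Const 1) (Var aEdges)))))))))) s1
     (1 + (b * (1 + 2) + 2) + (1 + (1 + (b * ((2 ^ b * ((1 + 1 + 1 + 1) + 2) + 2 + 1) + 2) + 2))
     + (1 + (b * ((1 + (b * (9 + 2) + 2)) + 2) + 2) + (2 * length [Const 0, Const 0] + 1 + (1 +
     (b * (((2 ^ b - 1) * (130 + 2) + 2) + 2) + 2 + (length cs * ((1 + (1 + (1 +
      (2 ^ b * ((2 ^ b * ((2 ^ b * ((130 + 1) + 2) + 2) + 2) + 2) + 2) + 2)))) + 2) + 2 + (1 + 1))))))))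
     (\<lambda>s'.
     s' aOut = list_mem ([2 * b + 6 * length gs, length (graph_edges (2 * b) (2 ^ b) gs)]
       @ graph_code (2 * b) (2 ^ b) gs) \<and>
     s' aVertex 0 = 2 * b + 6 * length gs \<and> s' aBudget 0 = 5 * 2 ^ b * length gs \<and>
     s' aIdx 0 = b * 2 ^ b \<and> s' aBits 0 = b)"
  proof (rule runs_Seq_frame[OF r2], goal_cases)
    case (1 s2)
    have p2: "s2 aQ 0 = 2 ^ b" "s2 aBits 0 = b" using 1 p1 by (simp_all add: writes_reduce_parts)
    show ?case
    proof (rule runs_Seq_frame[OF runs_compute_table[of s2 "2 ^ b" b, OF p2]], goal_cases)
      case (1 s3)
      have p3: "s3 aQ 0 = 2 ^ b" "s3 aBits 0 = b" using 1 p2 by (simp_all add: writes_reduce_parts)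
      have t3: "s3 aIdx 0 = b * 2 ^ b" "bit_table (2 ^ b) (b * 2 ^ b) s3" using 1 by auto
      show ?case
      proof (rule runs_Seq_frame[OF runs_compute_literals[of s3 "2 ^ b" b, OF p3]], goal_cases)
        case (1 s4)
        have p4: "s4 aQ 0 = 2 ^ b" "s4 aBits 0 = b" "s4 aIdx 0 = b * 2 ^ b"
          "bit_table (2 ^ b) (b * 2 ^ b) s4" "literal_tables b (2 ^ b) (2 * b * b) s4"
          using 1 p3 t3 by (simp_all add: writes_reduce_parts bit_table_def)
        have z4: "s4 aOut = list_mem []" "s4 aPtr 0 = 0" "s4 aEdges 0 = 0" "s4 aBudget 0 = 0" "s4 0 = s 0"
          using 1 \<open>\<And>a. a \<notin> writes compute_table \<Longrightarrow> s3 a = s2 a\<close>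
            \<open>\<And>a. a \<notin> writes compute_Q \<Longrightarrow> s2 a = s1 a\<close> f1 s0
          by (simp_all add: writes_reduce_parts list_mem_def)
        have r5: "runs (emit [Const 0, Const 0]) s4 (2 * length [Const 0, Const 0] + 1) (\<lambda>s'.
          s' aOut = list_mem [0, 0] \<and> s' aPtr 0 = 2)"
          by (rule runs_mono[OF runs_emit[where ys = "[]"]]) (use z4 in auto)
        show ?case
        proof (rule runs_Seq_frame[OF r5], goal_cases)
          case (1 s5)
          have p5: "s5 aQ 0 = 2 ^ b" "s5 aBits 0 = b" "s5 aIdx 0 = b * 2 ^ b" "s5 0 = s 0"
            "bit_table (2 ^ b) (b * 2 ^ b) s5" "literal_tables b (2 ^ b) (2 * b * b) s5"
            "s5 aEdges 0 = 0" "s5 aBudget 0 = 0"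
            using 1 p4 z4 by (simp_all add: writes_reduce_parts bit_table_def literal_tables_def)
          let ?s6 = "s5(aVertex := (s5 aVertex)(0 := b + b))"
          have p6: "?s6 aQ 0 = 2 ^ b" "?s6 aBits 0 = b" "?s6 aIdx 0 = b * 2 ^ b" "?s6 0 = s 0"
            "bit_table (2 ^ b) (b * 2 ^ b) ?s6" "literal_tables b (2 ^ b) (2 * b * b) ?s6"
            "emitted (2 * b) (2 ^ b) [] ?s6"
            using p5 1 by (auto simp: bit_table_def literal_tables_def emitted_def graph_code_def graph_edges_def)
          show ?case
          proof (rule runs_Seq_Write_eq[where i = 0 and v = "b + b"], goal_cases)
            case 3
            show ?case
            proof (rule runs_Seq_frame[OF runs_emit_pairs[OF p6(7,1,2)]], goal_cases)
              case (1 s7)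
              have f7: "s7 a = ?s6 a" if "a \<notin> {aJ, aX} \<union> emission_arrays" for a
                using that writes_reduce_parts(6) by (intro 1(2)) blast
              have g7: "s7 0 = ?s6 0" "s7 aQ = ?s6 aQ" "s7 aBits = ?s6 aBits" "s7 aIdx = ?s6 aIdx"
                "s7 aTable = ?s6 aTable" "s7 aSel = ?s6 aSel" "s7 aRow = ?s6 aRow" "s7 aSign = ?s6 aSign"
                by (rule f7, simp add: emission_arrays_def)+
              have p7: "s7 aQ 0 = 2 ^ b" "s7 aBits 0 = b" "s7 aIdx 0 = b * 2 ^ b" "s7 0 = s 0"
                "bit_table (2 ^ b) (b * 2 ^ b) s7" "literal_tables b (2 ^ b) (2 * b * b) s7"
                using p6 by (simp_all only: g7 bit_table_def literal_tables_def)
              note e7 = runs_emit_clauses[OF 1(1) p7(1) b0 p7(6,5), unfolded p7(4), OF m cs k']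
              show ?case
              proof (rule runs_Seq_frame[OF e7], goal_cases)
                case (3 s8)
                have f8: "s8 a = s7 a" if "a \<notin> {aC, aL1, aL2, aL3, aA1, aA2, aA3} \<union> emission_arrays" for a
                  using that writes_reduce_parts(7) by (intro 3(2)) blast
                have g8: "s8 aBits = s7 aBits" "s8 aIdx = s7 aIdx"
                  by (rule f8, simp add: emission_arrays_def)+
                have e: "emitted (2 * b) (2 ^ b) gs s8"
                  using 3(1) by (simp add: gs constraints_def)
                show ?case
                  by (intro runs_Seq_Write runs_Write)
                    (use e p7 in \<open>simp add: emitted_def g8 list_mem_update length_graph_edges\<close>)
              qed
            qed
          qed (simp_all add: p5)
        qed
      qed
    qed
  qed
qed

text \<open>The budget ends in \<open>b * (Q - 1)\<close>. Adding \<open>b\<close> to the other side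
  leaves \<open>b * Q\<close>, which \<open>aIdx\<close> still holds from the computation of the bit
  table.\<close>

definition decide :: prog where
  "decide = Seq (For aI (Var aVertex) (Set aSum (Add (Var aSum) (Read aPower (Var aI)))))
     (IfLess (Add (Var aBudget) (Var aIdx)) (Add (Var aSum) (Var aBits))
       (Set aResult (Const 0)) (Set aResult (Const 1)))"

lemma runs_decide:
  assumes "s aVertex 0 = n" "s aSum 0 = 0"
  shows "runs decide s (n * (1 + 2) + 2 + (1 + 1))
    (\<lambda>s'. s' aResult 0 = of_bool (sum (s aPower) {..<n} + s aBits 0 \<le> s aBudget 0 + s aIdx 0))"
  unfolding decide_def
proof (rule runs_Seq_frame)
  show "runs (For aI (Var aVertex) (Set aSum (Add (Var aSum) (Read aPower (Var aI))))) s (n * (1 + 2) + 2)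
    (\<lambda>s'. s' aSum 0 = sum (s aPower) {..<n})"
    by (rule runs_For[where I = "\<lambda>k s'. s' aSum 0 = sum (s aPower) {..<k}"])
      (use assms in \<open>auto intro!: runs_Write[simplified]\<close>)
next
  fix s1
  assume 1: "s1 aSum 0 = sum (s aPower) {..<n}" and "\<And>a. a \<notin> writes (For aI (Var aVertex)
      (Set aSum (Add (Var aSum) (Read aPower (Var aI))))) \<Longrightarrow> s1 a = s a"
  then have "s1 aBudget = s aBudget" "s1 aIdx = s aIdx" "s1 aBits = s aBits" by simp_all
  with 1 show "runs (IfLess (Add (Var aBudget) (Var aIdx)) (Add (Var aSum) (Var aBits))
       (Set aResult (Const 0)) (Set aResult (Const 1))) s1 (1 + 1)
     (\<lambda>s'. s' aResult 0 = of_bool (sum (s aPower) {..<n} + s aBits 0 \<le> s aBudget 0 + s aIdx 0))"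
    by (intro runs_IfLess runs_Write) auto
qed

section \<open>Running time\<close>

text \<open>The hypothesis on \<open>m\<close> comes from \<open>8 * n ^ 3\<close> clauses and
  \<open>n \<le> Q ^ 2\<close>. The dominant term is then \<open>m * Q ^ 3 \<le> 8 * Q ^ 9\<close>,
  so every summand is at most a multiple of \<open>P = Q ^ 9\<close>; the coefficients add up to
  less than \<open>2 ^ 11 \<le> Q ^ 11\<close>, and 9 + 11 = 20.\<close>

lemma reduce_time_le:
  assumes "0 < b" "m \<le> 8 * (2 ^ b) ^ 6"
  shows "reduce_time b m \<le> (2 ^ b) ^ 20"
proof -
  define Q :: nat where "Q = 2 ^ b"
  have Q2: "2 \<le> Q" unfolding Q_def using assms(1) power_increasing[of 1 b "2::nat"] by simp
  have bQ: "b \<le> Q" by (simp add: Q_def less_imp_le)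
  define P where "P = Q ^ 9"
  have pw: "Q ^ i \<le> P" if "i \<le> 9" for i
    unfolding P_def using that Q2 by (intro power_increasing) auto
  have 1: "1 \<le> P" "Q \<le> P" "Q * Q \<le> P" using pw[of 0] pw[of 1] pw[of 2] by (simp_all add: power2_eq_square)
  have 2: "b \<le> P" using bQ 1 by simp
  have 3: "b * b \<le> P" using mult_mono[OF bQ bQ] 1 by simp
  have 4: "b * Q \<le> P" by (rule order_trans[OF mult_le_mono1[OF bQ] 1(3)])
  have m: "m * Q ^ i \<le> 8 * P" if "i \<le> 3" for i
  proof -
    have "m * Q ^ i \<le> 8 * Q ^ 6 * Q ^ i" using assms(2) by (simp add: Q_def)
    also have "\<dots> = 8 * Q ^ (6 + i)" by (simp add: power_add)
    also have "\<dots> \<le> 8 * P" using that by (simp add: pw)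
    finally show ?thesis .
  qed
  have 5: "m \<le> 8 * P" "m * Q \<le> 8 * P" "m * Q\<^sup>2 \<le> 8 * P" "m * Q ^ 3 \<le> 8 * P"
    using m[of 0] m[of 1] m[of 2] m[of 3] by auto
  have "b * ((Q - 1) * 132) \<le> 132 * (b * Q)" by simp
  then have 6: "b * ((Q - 1) * 132) \<le> 132 * P" using 4 by linarith
  have "reduce_time b m = 3 * b + (3 * b + 3) + (6 * (b * Q) + 5 * b + 4)
      + (11 * (b * b) + 5 * b + 3) + 6 + (b * ((Q - 1) * 132) + 4 * b + 2)
      + (133 * (m * Q ^ 3) + 4 * (m * Q\<^sup>2) + 4 * (m * Q) + 7 * m + 2) + 2"
    unfolding reduce_time_def Let_def Q_def[symmetric]
    by (simp add: algebra_simps power2_eq_square power3_eq_cube del: One_nat_def diff_mult_distrib diff_mult_distrib2)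
  also have "\<dots> \<le> 2048 * P" using 1 2 3 4 5 6 by linarith
  also have "2048 = (2::nat) ^ 11" by simp
  also have "2 ^ 11 * P \<le> Q ^ 11 * P" using Q2 by (intro mult_right_mono power_mono) auto
  also have "\<dots> = Q ^ 20" by (simp add: P_def flip: power_add)
  finally show ?thesis by (simp add: Q_def)
qed

text \<open>Again \<open>Q ^ 9\<close> dominates, now with coefficient
  \<open>56 \<le> 2 ^ 6 \<le> Q ^ 6\<close>, which gives the exponent 15.\<close>

lemma vertex_count_le:
  assumes "0 < b" "length cs \<le> 8 * (2 ^ b) ^ 6"
  shows "2 * b + 6 * length (constraints b cs) \<le> (2 ^ b) ^ 15"
proof -
  define Q :: nat where "Q = 2 ^ b"
  have Q2: "2 \<le> Q" unfolding Q_def using assms(1) power_increasing[of 1 b "2::nat"] by simp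
  have bQ: "b \<le> Q" by (simp add: Q_def less_imp_le)
  have pw: "Q ^ i \<le> Q ^ 9" if "i \<le> 9" for i
    using that Q2 by (intro power_increasing) auto
  have "length (constraints b cs) \<le> b * Q + length cs * Q ^ 3"
    using length_constraints_le[of b cs] by (simp add: Q_def mult.commute flip: power_mult)
  also have "\<dots> \<le> Q * Q + (8 * Q ^ 6) * Q ^ 3"
    using bQ assms(2) by (intro add_mono mult_right_mono) (auto simp: Q_def)
  also have "\<dots> = Q ^ 2 + 8 * Q ^ 9" by (simp add: power2_eq_square flip: power_add)
  finally have "2 * b + 6 * length (constraints b cs) \<le> 2 * Q ^ 1 + 6 * (Q ^ 2 + 8 * Q ^ 9)"
    using bQ by simp
  also have "\<dots> \<le> 2 * Q ^ 9 + 6 * (Q ^ 9 + 8 * Q ^ 9)" by (intro add_mono mult_left_mono pw) auto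
  also have "\<dots> \<le> 2 ^ 6 * Q ^ 9" by simp
  also have "\<dots> \<le> Q ^ 6 * Q ^ 9" using Q2 by (intro mult_right_mono power_mono) auto
  also have "\<dots> = Q ^ 15" by (simp flip: power_add)
  finally show ?thesis by (simp add: Q_def)
qed

lemma length_three_cnf:
  assumes "three_cnf n \<phi>"
  shows "length \<phi> \<le> 8 * n ^ 3"
proof -
  let ?L = "{..<n} \<times> (UNIV :: bool set)"
  have "length \<phi> = card (set \<phi>)" using assms by (simp add: three_cnf_def distinct_card)
  also have "\<dots> \<le> card (?L \<times> ?L \<times> ?L)"
    using assms by (intro card_mono) (auto simp: three_cnf_def)
  also have "\<dots> = 8 * n ^ 3" by (simp add: card_cartesian_product power3_eq_cube)
  finally show ?thesis .
qed

text \<open>Rounding the root up at most doubles it: \<open>c + 1 \<le> 2 * c\<close> for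
  \<open>c = bits n - 1 > 0\<close>. So \<open>b * b\<close> is linear in \<open>n\<close>, and
  \<open>b\<close> times o(b) is o(n).\<close>

lemma bits_square_le: "bits n * bits n \<le> 4 * n + 1"
proof (cases "bits n \<le> 1")
  case True
  then show ?thesis using mult_mono[of "bits n" 1 "bits n" 1] by simp
next
  case False
  define c where "c = bits n - 1"
  have c: "bits n = c + 1" "0 < c" using False by (auto simp: c_def)
  have "\<not> n \<le> c * c" using bits_le[of c n] c by auto
  then have "c * c < n" by simp
  moreover have "(c + 1) * (c + 1) \<le> 4 * (c * c)"
  proof -
    have "(c + 1) * (c + 1) \<le> (2 * c) * (2 * c)" using c by (intro mult_mono) auto
    then show ?thesis by simp
  qed
  ultimately show ?thesis unfolding c by linarith
qed

lemma n_le_pow_bits: "n \<le> (2 ^ bits n) ^ 2"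
proof -
  have "bits n * bits n \<le> 2 ^ bits n * 2 ^ bits n" by (intro mult_mono) (auto simp: less_imp_le)
  then show ?thesis using bits(2)[of n] by (simp add: power2_eq_square)
qed

text \<open>Only an upper bound on the treewidth is known and \<open>f\<close> need not be monotone,
  so \<open>f\<close> is replaced by its running maximum. The absolute value makes it
  nonnegative.\<close>

definition max_upto :: "(nat \<Rightarrow> real) \<Rightarrow> nat \<Rightarrow> real" where
  "max_upto f k = Max ((\<lambda>t. \<bar>f t\<bar>) ` {..k})"

lemma le_max_upto: "t \<le> k \<Longrightarrow> f t \<le> max_upto f k" "0 \<le> max_upto f k"
proof -
  have *: "\<bar>f t\<bar> \<le> max_upto f k" if "t \<le> k" for t
    unfolding max_upto_def using that by (intro Max_ge) auto
  from * show "t \<le> k \<Longrightarrow> f t \<le> max_upto f k" by fastforce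
  from *[of 0] show "0 \<le> max_upto f k" by (meson abs_ge_zero order_trans zero_le)
qed

text \<open>The finitely many arguments before the asymptotic estimate sets in contribute a constant
  \<open>K\<close>, so the running maximum of \<open>f\<close> is still o(k).\<close>

lemma max_upto_bound:
  assumes "f \<in> o(\<lambda>t. real t)" "0 < c"
  obtains K where "\<And>k. max_upto f k \<le> K + c * real k"
proof -
  from assms have "eventually (\<lambda>t. \<bar>f t\<bar> \<le> c * real t) at_top"
    by (auto dest: landau_o.smallD)
  then obtain t0 where t0: "\<And>t. t \<ge> t0 \<Longrightarrow> \<bar>f t\<bar> \<le> c * real t" by (auto simp: eventually_at_top_linorder)
  define K where "K = (\<Sum>t<t0. \<bar>f t\<bar>)"
  have "max_upto f k \<le> K + c * real k" for k
    unfolding max_upto_def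
  proof (rule Max.boundedI)
    fix y assume "y \<in> (\<lambda>t. \<bar>f t\<bar>) ` {..k}"
    then obtain t where t: "t \<le> k" "y = \<bar>f t\<bar>" by auto
    show "y \<le> K + c * real k"
    proof (cases "t < t0")
      case True
      then have "\<bar>f t\<bar> \<le> K" unfolding K_def by (intro member_le_sum) auto
      moreover have "0 \<le> c * real k" using assms(2) by simp
      ultimately show ?thesis using t by linarith
    next
      case False
      then have "\<bar>f t\<bar> \<le> c * real t" using t0 by simp
      also have "\<dots> \<le> c * real k" using t assms(2) by simp
      finally have "\<bar>f t\<bar> \<le> c * real k" .
      moreover have "0 \<le> K" by (auto simp: K_def sum_nonneg)
      ultimately show ?thesis using t by linarith
    qed
  qed auto
  then show ?thesis by (rule that)
qed

lemma time_exponent_small_o: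
  assumes "f \<in> o(\<lambda>t. real t)"
  shows "(\<lambda>n. real (bits n) * (22 + 15 * max_upto f (2 * bits n + 5))) \<in> o(\<lambda>n. real n)"
proof (rule landau_o.smallI)
  fix c :: real assume c: "0 < c"
  \<comment> \<open>The estimates below end in \<open>31 * d * (5 * n)\<close>, and 155 is at most
    300.\<close>
  define d where "d = c / 300"
  have d: "0 < d" using c by (simp add: d_def)
  obtain K where K: "\<And>k. max_upto f k \<le> K + d * real k"
    using max_upto_bound[OF assms d] by blast
  \<comment> \<open>From \<open>b0\<close> on, \<open>d * b\<close> absorbs the constants;
    \<open>75 * d\<close> stems from 15 times the 5 in \<open>2 * b + 5\<close>, and the later 31 is
    2 * 15 + 1.\<close>
  define b0 where "b0 = nat \<lceil>(22 + 15 * K + 75 * d) / d\<rceil>"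
  have "\<bar>real (bits n) * (22 + 15 * max_upto f (2 * bits n + 5))\<bar> \<le> c * real n" if n: "n > b0 * b0" for n
  proof -
    define b where "b = real (bits n)"
    have "\<not> bits n < b0"
    proof
      assume "bits n < b0"
      then have "bits n * bits n \<le> b0 * b0" by (intro mult_le_mono) auto
      with bits(2)[of n] n show False by linarith
    qed
    then have "(22 + 15 * K + 75 * d) / d \<le> b" unfolding b_def b0_def by linarith
    then have K': "22 + 15 * K + 75 * d \<le> d * b" using d by (simp add: field_simps)
    have "max_upto f (2 * bits n + 5) \<le> K + d * (2 * b + 5)" using K[of "2 * bits n + 5"] by (simp add: b_def)
    then have "22 + 15 * max_upto f (2 * bits n + 5) \<le> 31 * d * b" using K' by (simp add: algebra_simps)
    then have "b * (22 + 15 * max_upto f (2 * bits n + 5)) \<le> b * (31 * d * b)"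
      by (intro mult_left_mono) (auto simp: b_def)
    also have "\<dots> = 31 * d * (b * b)" by simp
    also have "b * b \<le> 4 * real n + 1"
    proof -
      have "real (bits n * bits n) \<le> real (4 * n + 1)"
        using bits_square_le by (simp only: of_nat_le_iff)
      then show ?thesis by (simp add: b_def)
    qed
    also have "4 * real n + 1 \<le> 5 * real n" using n by simp
    finally have "b * (22 + 15 * max_upto f (2 * bits n + 5)) \<le> 31 * d * (5 * real n)"
      using d by simp
    also have "\<dots> \<le> c * real n" using c by (simp add: d_def)
    finally show ?thesis using le_max_upto(2)[of f "2 * bits n + 5"] by (simp add: b_def abs_mult)
  qed
  then show "eventually (\<lambda>n. norm (real (bits n) * (22 + 15 * max_upto f (2 * bits n + 5))) \<le> c * norm (real n)) at_top"
    unfolding eventually_at_top_dense by auto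
qed

section \<open>The program for 3-SAT\<close>

lemma concat_triples_nth:
  assumes "i < length cs" "r < 3"
  shows "concat (map (\<lambda>(x, y, z). [x, y, z]) cs) ! (3 * i + r) =
    [fst (cs ! i), fst (snd (cs ! i)), snd (snd (cs ! i))] ! r"
  using assms(1)
proof (induction cs arbitrary: i)
  case (Cons c cs)
  obtain x y z where c: "c = (x, y, z)" by (cases c)
  show ?case
  proof (cases i)
    case 0
    with assms(2) show ?thesis by (auto simp: c less_Suc_eq numeral_3_eq_3)
  next
    case (Suc j)
    have "concat (map (\<lambda>(x, y, z). [x, y, z]) (c # cs)) ! (3 * i + r) =
      ([x, y, z] @ concat (map (\<lambda>(x, y, z). [x, y, z]) cs)) ! (3 + (3 * j + r))"
      by (simp add: c Suc)
    also have "\<dots> = concat (map (\<lambda>(x, y, z). [x, y, z]) cs) ! (3 * j + r)"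
      by (simp add: nth_append)
    finally show ?thesis using Cons Suc by simp
  qed
qed simp

lemma input_memory_cnf:
  defines "s n \<phi> \<equiv> input_memory (cnf_code n \<phi>)"
  shows "0 < a \<Longrightarrow> s n \<phi> a = (\<lambda>_. 0)" "s n \<phi> 0 0 = n" "s n \<phi> 0 1 = length (map clause_codes \<phi>)"
    "c < length (map clause_codes \<phi>) \<Longrightarrow>
      (s n \<phi> 0 (3 * c + 2), s n \<phi> 0 (3 * c + 3), s n \<phi> 0 (3 * c + 4)) = map clause_codes \<phi> ! c"
proof -
  have e: "cnf_code n \<phi> = n # length \<phi> # concat (map (\<lambda>(x, y, z). [x, y, z]) (map clause_codes \<phi>))"
    by (auto simp: cnf_code_def comp_def case_prod_unfold)
  have len: "length (concat (map (\<lambda>(x, y, z). [x, y, z]) cs)) = 3 * length cs" for cs :: "(nat \<times> nat \<times> nat) list"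
    by (induction cs) auto
  show "0 < a \<Longrightarrow> s n \<phi> a = (\<lambda>_. 0)" "s n \<phi> 0 0 = n" "s n \<phi> 0 1 = length (map clause_codes \<phi>)"
    unfolding s_def e by (auto simp: input_memory_def)
  assume c: "c < length (map clause_codes \<phi>)"
  let ?cs = "map clause_codes \<phi>"
  have "s n \<phi> 0 (3 * c + 2 + r) = concat (map (\<lambda>(x, y, z). [x, y, z]) ?cs) ! (3 * c + r)" if "r < 3" for r
    using c that unfolding s_def e input_memory_def length_Cons len by (auto simp: numeral_2_eq_2)
  from this[of 0] this[of 1] this[of 2] concat_triples_nth[OF c, of 0]
    concat_triples_nth[OF c, of 1] concat_triples_nth[OF c, of 2]
  show "(s n \<phi> 0 (3 * c + 2), s n \<phi> 0 (3 * c + 3), s n \<phi> 0 (3 * c + 4)) = ?cs ! c"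
    by (simp add: prod_eq_iff numeral_3_eq_3 numeral_2_eq_2 eval_nat_numeral)
qed

definition sat_program :: "prog \<Rightarrow> prog" where
  "sat_program c = Seq reduce (Seq (shift_prog aOut c) decide)"

text \<open>The exponent has three sources: with \<open>F\<close> the running maximum of
  \<open>f\<close>, the solver takes at most \<open>Q powr (15 * F)\<close> steps, everything else
  at most \<open>2 * Q ^ 20\<close>, and the constants fit into
  \<open>4 \<le> 2 powr (2 * b)\<close>, so 22 = 20 + 2.\<close>

lemma sat_program_correct:
  assumes solves: "solves_pvc_on (weights_bounded 1) c f" and \<phi>: "three_cnf n \<phi>"
  shows "\<exists>T s'. exec (sat_program c) (input_memory (cnf_code n \<phi>)) T s' \<and>
     s' 1 0 = of_bool (satisfiable \<phi>) \<and>
     real T \<le> 2 powr (real (bits n) * (22 + 15 * max_upto f (2 * bits n + 5)))"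
proof -
  define b where "b = bits n"
  define Q :: nat where "Q = 2 ^ b"
  define cs where "cs = map clause_codes \<phi>"
  define gs where "gs = constraints b cs"
  define ts where "ts = graph_edges (2 * b) Q gs"
  define N where "N = 2 * b + 6 * length gs"
  define E where "E = edge_of ` set ts"
  define w where "w = edge_weight ts"
  define us where "us = map (\<lambda>(x, y, t). (x, y)) ts"
  have b: "0 < b" "n \<le> b * b" using bits by (auto simp: b_def)
  have Q2: "2 \<le> Q" unfolding Q_def using b(1) power_increasing[of 1 b "2::nat"] by simp
  have lits: "l1 < 2 * n \<and> l2 < 2 * n \<and> l3 < 2 * n" if "(l1, l2, l3) \<in> set cs" for l1 l2 l3
    using that \<phi> by (fastforce simp: cs_def three_cnf_def literal_code_def)
  have wf: "constraints_wf (2 * b) Q gs"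
    unfolding gs_def Q_def
  proof (rule constraints_wf_constraints)
    fix l1 l2 l3 assume "(l1, l2, l3) \<in> set cs"
    moreover have "2 * n \<le> 2 * b * b" using b(2) by simp
    ultimately show "l1 < 2 * b * b \<and> l2 < 2 * b * b \<and> l3 < 2 * b * b"
      using lits[of l1 l2 l3] by linarith
  qed
  have dist: "distinct (map edge_of ts)" unfolding ts_def by (rule distinct_graph_edges[OF wf])
  have "b * (Q - 1) \<le> length gs" unfolding gs_def Q_def by (rule length_constraints_ge)
  then have len: "Q - 1 \<le> length gs" using b(1) mult_le_mono1[of 1 b "Q - 1"] by linarith
  \<comment> \<open>There are at least as many vertices as the largest weight: this gives the bound
    with exponent 1 in \<open>wb\<close>.\<close>
  then have N: "Q \<le> N" and gs: "gs \<noteq> []" using Q2 by (auto simp: N_def)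
  have edge: "y < x" "x < N" "0 < t" "t \<le> Q" if "(x, y, t) \<in> set ts" for x y t
    using graph_edges_bounds[OF wf, of x y t] that Q2 by (auto simp: ts_def N_def)
  have inst: "pvc_instance {..<N} E w"
  proof -
    have "e \<in> {{u, v} |u v. u \<in> {..<N} \<and> v \<in> {..<N} \<and> u \<noteq> v} \<and> 0 < w e \<and> w e \<le> Q" if "e \<in> E" for e
    proof -
      from that obtain x y t where xyt: "(x, y, t) \<in> set ts" "e = {x, y}" by (auto simp: E_def)
      then have "w e = t" by (simp add: w_def edge_weight_eq[OF dist])
      with edge[OF xyt(1)] xyt(2) show ?thesis by force
    qed
    then show ?thesis by (auto simp: pvc_instance_def simple_graph_def)
  qed
  have wb: "weights_bounded 1 {..<N} E w"
    unfolding weights_bounded_def E_def w_def using edge N by (fastforce simp: edge_weight_eq[OF dist])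
  have lst: "edge_listing E us" unfolding E_def us_def by (rule edge_listing_edge_of[OF dist])
  have code: "pvc_code N us w = [N, length ts] @ graph_code (2 * b) Q gs"
    unfolding us_def w_def pvc_code_edge_weight[OF dist] by (simp add: graph_code_def ts_def)
  obtain T1 s1 where ex: "exec c (input_memory (pvc_code N us w)) T1 s1"
    and opt: "pvc_optimal {..<N} E w (\<lambda>v. real (s1 1 v))"
    and T1: "real T1 \<le> real N powr f (treewidth {..<N} E)"
  proof -
    have "2 \<le> N" using N Q2 by simp
    moreover have "pvc_instance {..<N} E w \<and> weights_bounded 1 {..<N} E w \<and> edge_listing E us"
      using inst wb lst by blast
    ultimately show ?thesis using solves that unfolding solves_pvc_on_def by blast
  qed
  have feas: "t \<le> s1 1 x \<or> t \<le> s1 1 y" if "(x, y, t) \<in> set ts" for x y t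
    using opt that unfolding pvc_optimal_def E_def w_def pvc_feasible_edge_weight[OF dist] by fastforce
  \<comment> \<open>A satisfying assignment gives a solution of exactly the budgeted cost, which an
    optimal one cannot exceed; conversely, any feasible solution within the budget yields a
    satisfying assignment.\<close>
  have iff: "satisfiable \<phi> \<longleftrightarrow> sum (s1 1) {..<N} + b \<le> 5 * Q * length gs + b * Q"
  proof
    assume "satisfiable \<phi>"
    then obtain X where X: "\<And>g. g \<in> set gs \<Longrightarrow> holds X g" "sum X {..<2 * b} = b * (Q - 1)"
      using satisfiable_imp_holds[OF _ \<phi> b(1)] unfolding gs_def cs_def Q_def by metis
    obtain q where q: "\<And>x y t. (x, y, t) \<in> set ts \<Longrightarrow> t \<le> q x \<or> t \<le> q y"
      "sum q {..<N} = sum X {..<2 * b} + 5 * Q * length gs"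
      using exists_solution[OF wf X(1)] unfolding ts_def N_def by blast
    have "pvc_feasible {..<N} E w (\<lambda>v. real (q v))"
      unfolding E_def w_def pvc_feasible_edge_weight[OF dist] using q(1) by auto
    then have "(\<Sum>v<N. real (s1 1 v)) \<le> (\<Sum>v<N. real (q v))"
      using opt unfolding pvc_optimal_def by blast
    then have "sum (s1 1) {..<N} \<le> sum q {..<N}" by (simp only: of_nat_sum[symmetric] of_nat_le_iff)
    moreover have "b * (Q - 1) + b = b * Q" using Q2 by (cases Q) auto
    ultimately show "sum (s1 1) {..<N} + b \<le> 5 * Q * length gs + b * Q" using q(2) X(2) by simp
  next
    assume le: "sum (s1 1) {..<N} + b \<le> 5 * Q * length gs + b * Q"
    have "sum (s1 1) {..<2 * b} + 5 * Q * length gs + length (filter (\<lambda>g. \<not> holds (s1 1) g) gs)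
      \<le> sum (s1 1) {..<N}"
      unfolding N_def using feas Q2 by (intro cost_lower_bound[OF wf]) (auto simp: ts_def)
    with le have "sum (s1 1) {..<2 * b} + length (filter (\<lambda>g. \<not> holds (s1 1) g) gs) \<le> b * Q - b" by linarith
    also have "b * Q - b = b * (Q - 1)" by (simp add: diff_mult_distrib2)
    finally show "satisfiable \<phi>"
      unfolding gs_def cs_def Q_def by (rule cheap_imp_satisfiable[OF b(1) \<phi> b(2)])
  qed
  let ?s0 = "input_memory (cnf_code n \<phi>)"
  have "runs reduce ?s0 (reduce_time b (length cs)) (\<lambda>s'. (
     s' aOut = list_mem ([2 * b + 6 * length gs, length (graph_edges (2 * b) (2 ^ b) gs)]
       @ graph_code (2 * b) (2 ^ b) gs) \<and>
     s' aVertex 0 = 2 * b + 6 * length gs \<and> s' aBudget 0 = 5 * 2 ^ b * length gs \<and>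
     s' aIdx 0 = b * 2 ^ b \<and> s' aBits 0 = b) \<and> (\<forall>a. a \<notin> writes reduce \<longrightarrow> s' a = ?s0 a))"
  proof (rule runs_frame, rule runs_reduce)
    show "?s0 a = (\<lambda>_. 0)" if "0 < a" for a using that by (rule input_memory_cnf(1))
    show "?s0 0 0 = n" by (rule input_memory_cnf(2))
    show "?s0 0 1 = length cs" unfolding cs_def by (rule input_memory_cnf(3))
    show "(?s0 0 (3 * c + 2), ?s0 0 (3 * c + 3), ?s0 0 (3 * c + 4)) = cs ! c" if "c < length cs" for c
      using that unfolding cs_def by (rule input_memory_cnf(4))
  qed (rule lits b_def gs_def; assumption?)+
  then obtain T0 s where ex0: "exec reduce ?s0 T0 s" and T0: "T0 \<le> reduce_time b (length cs)"
    and out: "s aOut = list_mem (pvc_code N us w)"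
    and s: "s aVertex 0 = N" "s aBudget 0 = 5 * Q * length gs" "s aIdx 0 = b * Q" "s aBits 0 = b"
    and fr: "\<And>a. a \<notin> writes reduce \<Longrightarrow> s a = ?s0 a"
    unfolding runs_def code unfolding ts_def N_def Q_def by blast
  have zero: "s a = (\<lambda>_. 0)" if "a = aSum \<or> aOut < a" for a
  proof -
    have "a \<notin> writes reduce" using that writes_reduce by force
    with that fr show ?thesis by (auto simp: input_memory_def fun_eq_iff)
  qed
  \<comment> \<open>The solver sees a fresh input memory: its array 0 is \<open>aOut\<close>, and
    the arrays above are zero. Arrays below \<open>aOut\<close> are carried along unchanged.\<close>
  have "s = stack aOut s (input_memory (pvc_code N us w))"
  proof (intro ext)
    fix a i
    consider "a < aOut" | "a = aOut" | "aOut < a" by linarith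
    then show "s a i = stack aOut s (input_memory (pvc_code N us w)) a i"
      by cases (simp_all add: stack_def out list_mem_def input_memory_def zero)
  qed
  then have ex1: "exec (shift_prog aOut c) s T1 (stack aOut s s1)"
    using exec_shift_prog[OF ex, of aOut s] by simp
  let ?s2 = "stack aOut s s1"
  have s2: "?s2 aVertex 0 = N" "?s2 aBudget 0 = 5 * Q * length gs" "?s2 aIdx 0 = b * Q" "?s2 aBits 0 = b"
    "?s2 aSum 0 = 0" "?s2 aPower = s1 1"
    using s zero by (auto simp: stack_def)
  obtain T2 s3 where ex2: "exec decide ?s2 T2 s3" and T2: "T2 \<le> N * (1 + 2) + 2 + (1 + 1)"
    and res: "s3 aResult 0 = of_bool (satisfiable \<phi>)"
    using runs_decide[of ?s2 N, OF s2(1,5)] unfolding runs_def iff s2 by blast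
  have "exec (sat_program c) ?s0 (T0 + (T1 + T2)) s3"
    unfolding sat_program_def by (rule exec.Seq[OF ex0 exec.Seq[OF ex1 ex2]])
  moreover have "real (T0 + (T1 + T2)) \<le> 2 powr (real (bits n) * (22 + 15 * max_upto f (2 * bits n + 5)))"
  proof -
    define F where "F = max_upto f (2 * b + 5)"
    have F: "0 \<le> F" "f (treewidth {..<N} E) \<le> F"
    proof -
      have "treewidth {..<N} E \<le> 2 * b + 5"
        unfolding N_def E_def ts_def by (rule treewidth_graph_edges[OF wf gs])
      then show "f (treewidth {..<N} E) \<le> F" "0 \<le> F" unfolding F_def by (auto intro: le_max_upto)
    qed
    have m: "length cs \<le> 8 * (2 ^ b) ^ 6"
    proof -
      have "length cs \<le> 8 * n ^ 3" using length_three_cnf[OF \<phi>] by (simp add: cs_def)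
      also have "\<dots> \<le> 8 * ((2 ^ b) ^ 2) ^ 3"
        using n_le_pow_bits[of n] by (intro mult_left_mono power_mono) (auto simp: b_def)
      finally show ?thesis by (simp add: mult.commute flip: power_mult)
    qed
    have NQ: "N \<le> Q ^ 15"
      unfolding N_def Q_def gs_def by (rule vertex_count_le[OF b(1) m])
    have "T0 \<le> Q ^ 20" using T0 reduce_time_le[OF b(1) m] by (simp add: Q_def)
    have "T2 \<le> Q ^ 20"
    proof -
      have "T2 \<le> 3 * N + 4" using T2 by simp
      then have "T2 \<le> 7 * N" using N Q2 by linarith
      also have "\<dots> \<le> Q ^ 3 * Q ^ 15" using NQ power_mono[OF Q2, of 3] by (intro mult_mono) auto
      also have "\<dots> = Q ^ 18" by (simp flip: power_add)
      also have "\<dots> \<le> Q ^ 20" using Q2 by (intro power_increasing) auto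
      finally show ?thesis .
    qed
    have T02: "real T0 + real T2 \<le> 2 * real Q ^ 20"
    proof -
      have "T0 + T2 \<le> 2 * Q ^ 20" using \<open>T0 \<le> Q ^ 20\<close> \<open>T2 \<le> Q ^ 20\<close> by simp
      then have "real (T0 + T2) \<le> real (2 * Q ^ 20)" by (simp only: of_nat_le_iff)
      then show ?thesis by simp
    qed
    have Qp: "real Q = 2 powr real b" by (simp add: Q_def powr_realpow)
    have Qpow: "real Q ^ k = 2 powr (real k * real b)" for k
      by (simp add: Qp powr_power mult.commute)
    have "real N powr f (treewidth {..<N} E) \<le> real N powr F"
      using F(2) N Q2 by (intro powr_mono) auto
    with T1 have "real T1 \<le> real N powr F" by linarith
    also have "\<dots> \<le> (real Q ^ 15) powr F"
      using NQ F(1) by (intro powr_mono2) (auto simp flip: of_nat_power)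
    also have "\<dots> = 2 powr (15 * real b * F)" unfolding Qpow by (simp add: powr_powr)
    finally have T1': "real T1 \<le> 2 powr (15 * real b * F)" .
    let ?x = "2 powr (20 * real b)" and ?y = "2 powr (15 * real b * F)"
    have x: "1 \<le> ?x" "1 \<le> ?y" using F(1) by (auto intro!: ge_one_powr_ge_zero)
    have "real (T0 + (T1 + T2)) \<le> 2 * ?x + ?y" using T02 T1' unfolding Qpow by simp
    also have "\<dots> \<le> 4 * (?x * ?y)"
    proof -
      have "?x \<le> ?x * ?y" using mult_left_mono[OF x(2), of ?x] by simp
      moreover have "?y \<le> ?x * ?y" using mult_right_mono[OF x(1), of ?y] by simp
      moreover have "0 \<le> ?x * ?y" by simp
      ultimately show ?thesis by linarith
    qed
    also have "4 * (?x * ?y) \<le> 2 powr (2 * real b) * (?x * ?y)"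
    proof -
      have "(2::real) powr 2 \<le> 2 powr (2 * real b)" using b(1) by (intro powr_mono) auto
      then show ?thesis by (intro mult_right_mono) auto
    qed
    also have "\<dots> = 2 powr (real b * (22 + 15 * F))" by (simp add: powr_add[symmetric] algebra_simps)
    finally show ?thesis unfolding F_def b_def .
  qed
  ultimately show ?thesis using res by blast
qed

lemma weights_bounded_imp_not_ETH:
  assumes "pvc_in_time_V_pow_little_o_tw (weights_bounded 1)"
  shows "\<not> ETH"
proof -
  from assms obtain c f where f: "f \<in> o(\<lambda>t. real t)" and c: "solves_pvc_on (weights_bounded 1) c f"
    unfolding pvc_in_time_V_pow_little_o_tw_def by blast
  have "decides_3sat (sat_program c) (\<lambda>n. real (bits n) * (22 + 15 * max_upto f (2 * bits n + 5)))"
    unfolding decides_3sat_def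
  proof (intro allI impI)
    fix n \<phi> assume "three_cnf n \<phi>"
    from sat_program_correct[OF c this] obtain T s'
      where "exec (sat_program c) (input_memory (cnf_code n \<phi>)) T s'"
        "s' 1 0 = of_bool (satisfiable \<phi>)"
        "real T \<le> 2 powr (real (bits n) * (22 + 15 * max_upto f (2 * bits n + 5)))"
      by blast
    then show "\<exists>T s'. exec (sat_program c) (input_memory (cnf_code n \<phi>)) T s' \<and>
      (if satisfiable \<phi> then s' 1 0 = 1 else s' 1 0 = 0) \<and>
      real T \<le> 2 powr (real (bits n) * (22 + 15 * max_upto f (2 * bits n + 5)))"
      by (intro exI[of _ T] exI[of _ s']) simp
  qed
  with time_exponent_small_o[OF f] show ?thesis unfolding ETH_def by blast
qed

theorem theorem2:
  shows "(pvc_in_time_V_pow_little_o_tw all_weights \<longrightarrow> \<not> ETH) \<and>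
         (\<exists>d. pvc_in_time_V_pow_little_o_tw (weights_bounded d) \<longrightarrow> \<not> ETH)"
proof -
  have "pvc_in_time_V_pow_little_o_tw all_weights \<Longrightarrow> pvc_in_time_V_pow_little_o_tw (weights_bounded 1)"
    unfolding pvc_in_time_V_pow_little_o_tw_def solves_pvc_on_def all_weights_def by blast
  with weights_bounded_imp_not_ETH show ?thesis by blast
qed

end
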